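(* Let $C_1,C_2$ be positive integers, let $G^{\circ}\in\mathcal{N}^{\circ}(C_1,C_2)$, and let $G^{\circ}_{\mathrm{p}}$ be the subgraph of $G^{\circ}$ induced on all private edges of $G^{\circ}$. Then $G^{\circ}_{\mathrm{p}}$ consists of $(C_1+C_2)$ alternating paths; that is, the edge set of $G^{\circ}_{\mathrm{p}}$ is the disjoint union of the edge sets of $C_1+C_2$ alternating paths.
   Context: Networks are finite loopless graphs (parallel edges allowed). A source is a vertex incident only with outgoing edges, a sink is a vertex incident only with incoming edges; sources and sinks are called terminal vertices. $\mathcal{N}(C_1,C_2)$ is the set of finite networks $G$ with two sources $S_1,S_2$ and two sinks $R_1,R_2$ (all distinct), in which all edges not incident with a source or sink are undirected (edges incident with a source or sink are directed out of the source, respectively into the sink), and such that for $i=1,2$ the minimum vertex-cut from $S_i$ to $R_i$ is $C_i$, i.e. (Menger) the maximum number of paths from $S_i$ to $R_i$ (respecting directed edges) pairwise sharing no vertices other than $S_i,R_i$ is $C_i$. A graph $G\in\mathcal{N}(C_1,C_2)$ is minimal if $G\setminus\{e\}\notin\mathcal{N}(C_1,C_2)$ for every edge $e$. Choose a set $\phi$ of $C_1$ vertex-disjoint (apart from $S_1,R_1$) paths from $S_1$ to $R_1$ and a set $\psi$ of $C_2$ vertex-disjoint (apart from $S_2,R_2$) paths from $S_2$ to $R_2$; in a minimal graph every edge lies on some $\phi$-path or $\psi$-path. An edge is public if it is shared by a $\phi$-path and a $\psi$-path, and private otherwise. Traversing $\phi$-paths from $S_1$ to $R_1$ and $\psi$-paths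 from $S_2$ to $R_2$ gives natural $\phi$- and $\psi$-directions of edges; $G$ is naturally orientable if each public edge has the same natural $\phi$-direction and $\psi$-direction. $\mathcal{N}^{\circ}(C_1,C_2)$ is the set of all $G\in\mathcal{N}(C_1,C_2)$ that are minimal, naturally orientable, and all of whose non-terminal vertices have degree $3$. An alternating path in $G^{\circ}\in\mathcal{N}^{\circ}(C_1,C_2)$ is a path (edge directions are disregarded when traversing it) all of whose edges are private, whose pair of end vertices is one of $(S_1,S_2)$, $(S_1,R_1)$, $(R_2,S_2)$, $(R_2,R_1)$, and whose interior vertices are non-terminal. *)

theory Defs
  imports Main "HOL-Library.Disjoint_Sets"
begin

text \<open>
  Mixed multigraphs with four designated terminals. \<open>trav G e\<close> is the set of ways in which the
  edge \<open>e\<close> may be traversed: \<open>{(u, v)}\<close> for an edge directed from \<open>u\<close> to \<open>v\<close>, and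
  \<open>{(u, v), (v, u)}\<close> for an undirected edge between \<open>u\<close> and \<open>v\<close>.
\<close>

record ('v, 'e) network =
  verts :: "'v set"
  edges :: "'e set"
  trav :: "'e \<Rightarrow> ('v \<times> 'v) set"
  src1 :: 'v
  src2 :: 'v
  snk1 :: 'v
  snk2 :: 'v

definition terminals :: "('v, 'e) network \<Rightarrow> 'v set" where
  "terminals G = {src1 G, src2 G, snk1 G, snk2 G}"

definition ends :: "('v, 'e) network \<Rightarrow> 'e \<Rightarrow> 'v set" where
  "ends G e = Field (trav G e)"

definition undirected_edge :: "('v, 'e) network \<Rightarrow> 'e \<Rightarrow> bool" where
  "undirected_edge G e \<longleftrightarrow> (\<exists>u v. u \<noteq> v \<and> trav G e = {(u, v), (v, u)})"

definition directed_edge :: "('v, 'e) network \<Rightarrow> 'e \<Rightarrow> bool" where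
  "directed_edge G e \<longleftrightarrow> (\<exists>u v. u \<noteq> v \<and> trav G e = {(u, v)})"

definition degree :: "('v, 'e) network \<Rightarrow> 'v \<Rightarrow> nat" where
  "degree G v = card {e \<in> edges G. v \<in> ends G e}"

definition finite_loopless :: "('v, 'e) network \<Rightarrow> bool" where
  "finite_loopless G \<longleftrightarrow> finite (verts G) \<and> finite (edges G) \<and>
     (\<forall>e \<in> edges G. ends G e \<subseteq> verts G \<and> (directed_edge G e \<or> undirected_edge G e))"

definition is_source :: "('v, 'e) network \<Rightarrow> 'v \<Rightarrow> bool" where
  "is_source G s \<longleftrightarrow> s \<in> verts G \<and>
     (\<forall>e \<in> edges G. s \<in> ends G e \<longrightarrow> (\<exists>v. trav G e = {(s, v)}))"

definition is_sink :: "('v, 'e) network \<Rightarrow> 'v \<Rightarrow> bool" where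
  "is_sink G r \<longleftrightarrow> r \<in> verts G \<and>
     (\<forall>e \<in> edges G. r \<in> ends G e \<longrightarrow> (\<exists>v. trav G e = {(v, r)}))"

text \<open>
  A walk is the list of its steps \<open>(u, e, v)\<close>, each meaning that \<open>e\<close> is traversed from \<open>u\<close> to \<open>v\<close>.
  The parameter \<open>T\<close> says which steps are allowed.
\<close>

type_synonym ('v, 'e) step = "'v \<times> 'e \<times> 'v"

fun walk :: "('v, 'e) step set \<Rightarrow> 'v \<Rightarrow> ('v, 'e) step list \<Rightarrow> 'v \<Rightarrow> bool" where
  "walk T u [] v \<longleftrightarrow> u = v"
| "walk T u ((a, e, b) # p) v \<longleftrightarrow> a = u \<and> (a, e, b) \<in> T \<and> walk T b p v"

definition walk_verts :: "'v \<Rightarrow> ('v, 'e) step list \<Rightarrow> 'v list" where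
  "walk_verts u p = u # map (\<lambda>(_, _, b). b) p"

definition walk_edges :: "('v, 'e) step list \<Rightarrow> 'e set" where
  "walk_edges p = (\<lambda>(_, e, _). e) ` set p"

definition path :: "('v, 'e) step set \<Rightarrow> 'v \<Rightarrow> ('v, 'e) step list \<Rightarrow> 'v \<Rightarrow> bool" where
  "path T u p v \<longleftrightarrow> walk T u p v \<and> distinct (walk_verts u p)"

definition directed_steps :: "('v, 'e) network \<Rightarrow> ('v, 'e) step set" where
  "directed_steps G = {(u, e, v). e \<in> edges G \<and> (u, v) \<in> trav G e}"

text \<open>The steps available when edge directions are disregarded.\<close>

definition undirected_steps :: "('v, 'e) network \<Rightarrow> ('v, 'e) step set" where
  "undirected_steps G = {(u, e, v). e \<in> edges G \<and> (u, v) \<in> trav G e \<union> (trav G e)\<inverse>}"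

definition disjoint_paths ::
  "('v, 'e) network \<Rightarrow> 'v \<Rightarrow> 'v \<Rightarrow> ('v, 'e) step list set \<Rightarrow> bool" where
  "disjoint_paths G s r \<phi> \<longleftrightarrow> finite \<phi> \<and> (\<forall>p \<in> \<phi>. path (directed_steps G) s p r) \<and>
     (\<forall>p \<in> \<phi>. \<forall>q \<in> \<phi>. p \<noteq> q \<longrightarrow> set (walk_verts s p) \<inter> set (walk_verts s q) \<subseteq> {s, r})"

text \<open>
  Vertex connectivity as the maximum number of vertex-disjoint paths; unlike the size of a
  separating vertex set, this also makes sense when an edge joins \<open>s\<close> to \<open>r\<close> directly.
\<close>

definition max_disjoint_paths :: "('v, 'e) network \<Rightarrow> 'v \<Rightarrow> 'v \<Rightarrow> nat \<Rightarrow> bool" where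
  "max_disjoint_paths G s r C \<longleftrightarrow> (\<exists>\<phi>. disjoint_paths G s r \<phi> \<and> card \<phi> = C) \<and>
     (\<forall>\<phi>. disjoint_paths G s r \<phi> \<longrightarrow> card \<phi> \<le> C)"

text \<open>That edges at a terminal are directed is part of \<open>is_source\<close> and \<open>is_sink\<close>.\<close>

definition networks :: "nat \<Rightarrow> nat \<Rightarrow> ('v, 'e) network set" where
  "networks C1 C2 = {G. finite_loopless G \<and> distinct [src1 G, src2 G, snk1 G, snk2 G] \<and>
     is_source G (src1 G) \<and> is_source G (src2 G) \<and> is_sink G (snk1 G) \<and> is_sink G (snk2 G) \<and>
     (\<forall>e \<in> edges G. ends G e \<inter> terminals G = {} \<longrightarrow> undirected_edge G e) \<and>
     max_disjoint_paths G (src1 G) (snk1 G) C1 \<and> max_disjoint_paths G (src2 G) (snk2 G) C2}"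

definition delete_edge :: "('v, 'e) network \<Rightarrow> 'e \<Rightarrow> ('v, 'e) network" where
  "delete_edge G e = G\<lparr>edges := edges G - {e}\<rparr>"

definition minimal_network :: "nat \<Rightarrow> nat \<Rightarrow> ('v, 'e) network \<Rightarrow> bool" where
  "minimal_network C1 C2 G \<longleftrightarrow> G \<in> networks C1 C2 \<and>
     (\<forall>e \<in> edges G. delete_edge G e \<notin> networks C1 C2)"

definition path_choice :: "nat \<Rightarrow> nat \<Rightarrow> ('v, 'e) network \<Rightarrow>
    ('v, 'e) step list set \<Rightarrow> ('v, 'e) step list set \<Rightarrow> bool" where
  "path_choice C1 C2 G \<phi> \<psi> \<longleftrightarrow>
     disjoint_paths G (src1 G) (snk1 G) \<phi> \<and> card \<phi> = C1 \<and>
     disjoint_paths G (src2 G) (snk2 G) \<psi> \<and> card \<psi> = C2"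

definition public_edges ::
  "('v, 'e) step list set \<Rightarrow> ('v, 'e) step list set \<Rightarrow> 'e set" where
  "public_edges \<phi> \<psi> = (\<Union>p \<in> \<phi>. walk_edges p) \<inter> (\<Union>q \<in> \<psi>. walk_edges q)"

definition private_edges :: "('v, 'e) network \<Rightarrow>
    ('v, 'e) step list set \<Rightarrow> ('v, 'e) step list set \<Rightarrow> 'e set" where
  "private_edges G \<phi> \<psi> = edges G - public_edges \<phi> \<psi>"

definition private_subgraph :: "('v, 'e) network \<Rightarrow>
    ('v, 'e) step list set \<Rightarrow> ('v, 'e) step list set \<Rightarrow> ('v, 'e) network" where
  "private_subgraph G \<phi> \<psi> =
     G\<lparr>verts := (\<Union>e \<in> private_edges G \<phi> \<psi>. ends G e), edges := private_edges G \<phi> \<psi>\<rparr>"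

text \<open>
  The directions in which the paths of \<open>\<phi>\<close> traverse \<open>e\<close>. For vertex-disjoint paths this set has
  at most one element.
\<close>

definition natural_direction :: "('v, 'e) step list set \<Rightarrow> 'e \<Rightarrow> ('v \<times> 'v) set" where
  "natural_direction \<phi> e = {(u, v). \<exists>p \<in> \<phi>. (u, e, v) \<in> set p}"

definition naturally_oriented ::
  "('v, 'e) step list set \<Rightarrow> ('v, 'e) step list set \<Rightarrow> bool" where
  "naturally_oriented \<phi> \<psi> \<longleftrightarrow>
     (\<forall>e \<in> public_edges \<phi> \<psi>. natural_direction \<phi> e = natural_direction \<psi> e)"

definition naturally_orientable :: "nat \<Rightarrow> nat \<Rightarrow> ('v, 'e) network \<Rightarrow> bool" where
  "naturally_orientable C1 C2 G \<longleftrightarrow>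
     (\<exists>\<phi> \<psi>. path_choice C1 C2 G \<phi> \<psi> \<and> naturally_oriented \<phi> \<psi>)"

definition oriented_networks :: "nat \<Rightarrow> nat \<Rightarrow> ('v, 'e) network set" where
  "oriented_networks C1 C2 = {G. minimal_network C1 C2 G \<and> naturally_orientable C1 C2 G \<and>
     (\<forall>v \<in> verts G - terminals G. degree G v = 3)}"

definition alternating_path :: "('v, 'e) network \<Rightarrow>
    ('v, 'e) step list set \<Rightarrow> ('v, 'e) step list set \<Rightarrow> ('v, 'e) step list \<Rightarrow> bool" where
  "alternating_path G \<phi> \<psi> p \<longleftrightarrow>
     (\<exists>a b. (a, b) \<in> {(src1 G, src2 G), (src1 G, snk1 G), (snk2 G, src2 G), (snk2 G, snk1 G)} \<and>
        path (undirected_steps G) a p b \<and>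
        walk_edges p \<subseteq> private_edges G \<phi> \<psi> \<and>
        (set (walk_verts a p) - {a, b}) \<inter> terminals G = {})"

end

theory Submission imports Defs begin

text \<open>
  Minimality forces every choice of path families \<open>(\<phi>, \<psi>)\<close> to cover all edges
  (\<open>minimal_network_covered\<close>). A family of disjoint paths uses two edges or none at a non-terminal
  vertex, so degree 3 means that both families pass through it and share exactly one of its three
  edges there (\<open>at_vertex\<close>). Two consequences carry the proof.

  The edge sets of the families do not depend on the choice (\<open>family_edges_unique\<close>). A path of
  \<open>\<psi>\<close> begins with an edge at the second source, which no path of \<open>\<phi>\<close> can use, and at each vertex
  that it passes exactly one of its two edges is shared. So along it private and shared edges
  alternate, and which edges of \<open>\<psi>\<close> belong to \<open>\<phi>\<close> is determined by \<open>\<psi>\<close> alone; all edges outside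
  \<open>\<psi>\<close> belong to \<open>\<phi>\<close> anyway. Since alternating paths mention the families only through their private
  edges, it is enough to treat the naturally oriented choice that the hypothesis provides.

  For that choice, traverse the private \<open>\<phi>\<close>-edges forwards and the private \<open>\<psi>\<close>-edges backwards. The
  shared edge at a vertex is outgoing for both families or incoming for both. In the first case both
  private edges are incoming, in the second both are outgoing; after reversal of \<open>\<psi>\<close> exactly one step
  enters the vertex and one leaves it (\<open>alternation_cases\<close>). The first source and the second sink
  only emit steps, the second source and the first sink only receive them. Such a set of steps splits
  into threads that meet only at terminals, one for each step that leaves a starting vertex, and a residue in
  which every step has a successor and a predecessor, that is, a union of cycles. The number of
  threads is \<open>C1 + C2\<close>, and the threads are the alternating paths.

  It remains to exclude cycles (\<open>residue_empty\<close>). On a cycle one can exchange the private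
  \<open>\<phi>\<close>-edges for the private \<open>\<psi>\<close>-edges: at each vertex of the cycle the two have the same direction
  and the shared edge continues both, so the rerouted steps again contain equally many disjoint paths
  from the first source to the first sink. These paths and \<open>\<psi>\<close> avoid the exchanged private
  \<open>\<phi>\<close>-edges, in contradiction to the covering property.
\<close>

abbreviation tail :: "('v, 'e) step \<Rightarrow> 'v" where "tail x \<equiv> fst x"
abbreviation edge :: "('v, 'e) step \<Rightarrow> 'e" where "edge x \<equiv> fst (snd x)"
abbreviation head :: "('v, 'e) step \<Rightarrow> 'v" where "head x \<equiv> snd (snd x)"

definition family_steps :: "('v, 'e) step list set \<Rightarrow> ('v, 'e) step set" where
  "family_steps \<phi> = (\<Union>p \<in> \<phi>. set p)"

definition family_edges :: "('v, 'e) step list set \<Rightarrow> 'e set" where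
  "family_edges \<phi> = (\<Union>p \<in> \<phi>. walk_edges p)"

lemma family_edges_eq_image: "family_edges \<phi> = edge ` family_steps \<phi>"
  by (simp add: family_edges_def family_steps_def walk_edges_def split_def image_UN)

section \<open>Walks by position\<close>

lemma length_walk_verts [simp]: "length (walk_verts u p) = Suc (length p)"
  by (simp add: walk_verts_def)

lemma walk_verts_0 [simp]: "walk_verts u p ! 0 = u"
  by (simp add: walk_verts_def)

lemma walk_verts_Suc: "i < length p \<Longrightarrow> walk_verts u p ! Suc i = head (p ! i)"
  by (simp add: walk_verts_def split_def)

lemma set_walk_verts: "set (walk_verts u p) = insert u (head ` set p)"
  by (auto simp: walk_verts_def split_def)

lemma walk_verts_snoc: "walk_verts u (p @ [x]) = walk_verts u p @ [head x]"
  by (simp add: walk_verts_def split_def)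

lemma walk_subset: "walk T u p v \<Longrightarrow> set p \<subseteq> T"
  by (induction T u p v rule: walk.induct) auto

text \<open>
  The steps themselves are what makes a walk, so a walk may be restricted to, or moved to, any set
  that contains its steps.
\<close>
lemma walk_mono: "walk T u p v \<Longrightarrow> set p \<subseteq> T' \<Longrightarrow> walk T' u p v"
  by (induction T u p v rule: walk.induct) auto

lemma walk_tail_nth: "walk T u p v \<Longrightarrow> i < length p \<Longrightarrow> tail (p ! i) = walk_verts u p ! i"
proof (induction T u p v arbitrary: i rule: walk.induct)
  case (2 T u a e b p v)
  then show ?case
    by (cases i) (auto simp: walk_verts_def)
qed auto

lemma walk_end: "walk T u p v \<Longrightarrow> walk_verts u p ! length p = v"
  by (induction T u p v rule: walk.induct) (auto simp: walk_verts_def)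

lemma walk_snoc: "walk T u p v \<Longrightarrow> x \<in> T \<Longrightarrow> tail x = v \<Longrightarrow> walk T u (p @ [x]) (head x)"
  by (induction T u p v rule: walk.induct) (cases x; auto)+

lemma walk_head_nth:
  assumes "walk T u p v" "Suc i < length p"
  shows "head (p ! i) = tail (p ! Suc i)"
  using assms by (simp add: walk_tail_nth walk_verts_Suc)

lemma path_position_unique:
  assumes "path T u p v" "i \<le> length p" "j \<le> length p" "walk_verts u p ! i = walk_verts u p ! j"
  shows "i = j"
  using assms by (simp add: path_def nth_eq_iff_index_eq)

lemma path_distinct_steps:
  assumes "path T u p v" shows "distinct p"
proof -
  have "distinct (map head p)"
    using assms by (simp add: path_def walk_verts_def split_def)
  then show ?thesis by (simp add: distinct_map)
qed

section \<open>Linkages\<close>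

text \<open>
  A set of steps in which every vertex outside \<open>A \<union> B\<close> is entered and left at most once, and left
  whenever it is entered and conversely. Vertices of \<open>A\<close> only emit and vertices of \<open>B\<close> only receive
  steps, in any number. The locale serves three purposes: for the steps of a family of disjoint
  paths, for the alternating steps, and for the rerouted steps.
\<close>
locale linkage =
  fixes D :: "('v, 'e) step set" and A B :: "'v set"
  assumes finite_steps: "finite D"
    and head_notin: "x \<in> D \<Longrightarrow> head x \<notin> A"
    and tail_notin: "x \<in> D \<Longrightarrow> tail x \<notin> B"
    and succ_ex: "x \<in> D \<Longrightarrow> head x \<notin> B \<Longrightarrow> \<exists>y \<in> D. tail y = head x"
    and pred_ex: "x \<in> D \<Longrightarrow> tail x \<notin> A \<Longrightarrow> \<exists>y \<in> D. head y = tail x"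
    and tail_inj: "x \<in> D \<Longrightarrow> y \<in> D \<Longrightarrow> tail x = tail y \<Longrightarrow> tail x \<notin> A \<Longrightarrow> x = y"
    and head_inj: "x \<in> D \<Longrightarrow> y \<in> D \<Longrightarrow> head x = head y \<Longrightarrow> head x \<notin> B \<Longrightarrow> x = y"
begin

definition thread :: "('v, 'e) step \<Rightarrow> ('v, 'e) step list \<Rightarrow> bool" where
  "thread x p \<longleftrightarrow> (\<exists>b \<in> B. path D (tail x) p b) \<and> p \<noteq> [] \<and> hd p = x"

text \<open>
  A longest path that begins with \<open>x\<close> must end in \<open>B\<close>: otherwise its last vertex has an outgoing step,
  and this cannot lead back to the path, because every vertex is entered only once and \<open>A\<close> is never
  entered.
\<close>
lemma thread_exists:
  assumes x: "x \<in> D" "tail x \<in> A"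
  shows "\<exists>p. thread x p"
proof -
  define Q where "Q p \<longleftrightarrow> (\<exists>v. path D (tail x) p v) \<and> p \<noteq> [] \<and> hd p = x" for p
  have "Q [x]"
    using x head_notin[OF x(1)] by (cases x) (auto simp: Q_def path_def walk_verts_def)
  moreover have "length p < Suc (card D)" if "Q p" for p
  proof -
    obtain v where v: "path D (tail x) p v" using \<open>Q p\<close> by (auto simp: Q_def)
    have "length p = card (set p)"
      using path_distinct_steps[OF v] by (simp add: distinct_card)
    also have "\<dots> \<le> card D"
      using v finite_steps walk_subset[of D "tail x" p v] by (intro card_mono) (simp_all add: path_def)
    finally show ?thesis by simp
  qed
  ultimately obtain p where p: "Q p" and longest: "\<And>q. Q q \<Longrightarrow> length q \<le> length p"
    using ex_has_greatest_nat[of Q "[x]" length "Suc (card D)"] by (meson less_imp_le)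
  then obtain v where v: "path D (tail x) p v" and ne: "p \<noteq> []" and hd: "hd p = x"
    by (auto simp: Q_def)
  have w: "walk D (tail x) p v" using v by (simp add: path_def)
  have "v \<in> B"
  proof (rule ccontr)
    assume vB: "v \<notin> B"
    have "head (last p) = v"
      using walk_end[OF w] ne walk_verts_Suc[of "length p - 1" p "tail x"]
      by (simp add: last_conv_nth)
    moreover have "last p \<in> D" using ne walk_subset[OF w] by auto
    ultimately obtain y where y: "y \<in> D" "tail y = v" using succ_ex vB by blast
    have "head y \<notin> set (walk_verts (tail x) p)"
    proof
      assume "head y \<in> set (walk_verts (tail x) p)"
      then obtain i where i: "i < length p" "head (p ! i) = head y"
        using head_notin[OF y(1)] x(2) by (auto simp: set_walk_verts in_set_conv_nth)
      have piD: "p ! i \<in> D" using i walk_subset[OF w] by auto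
      show False
      proof (cases "head y \<in> B")
        case True
        show False
        proof (cases "Suc i < length p")
          case True
          then have "tail (p ! Suc i) \<in> B"
            using walk_head_nth[OF w True] i \<open>head y \<in> B\<close> by simp
          moreover have "p ! Suc i \<in> D" using True walk_subset[OF w] by auto
          ultimately show False using tail_notin by blast
        next
          case False
          then have "Suc i = length p" using i by simp
          then have "head y = v" using i walk_verts_Suc[of i p "tail x"] walk_end[OF w] by simp
          then show False using vB \<open>head y \<in> B\<close> by simp
        qed
      next
        case False
        then have "p ! i = y" using head_inj piD y i by auto
        then have "walk_verts (tail x) p ! i = walk_verts (tail x) p ! length p"
          using walk_tail_nth[OF w i(1)] walk_end[OF w] y by simp
        then have "i = length p" using i(1) by (intro path_position_unique[OF v]) simp_all
        then show False using i(1) by simp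
      qed
    qed
    then have "path D (tail x) (p @ [y]) (head y)"
      using v y walk_snoc[OF w y] by (simp add: path_def walk_verts_snoc)
    then have "Q (p @ [y])" using ne hd by (auto simp: Q_def)
    then show False using longest by fastforce
  qed
  then show ?thesis using v ne hd by (auto simp: thread_def)
qed

lemma thread_nth:
  assumes "thread x p" "i < length p"
  shows "p ! i \<in> D"
  using assms walk_subset unfolding thread_def path_def by (metis nth_mem subsetD)

lemma thread_nth_Suc:
  assumes "thread x p" "Suc i < length p"
  shows "head (p ! i) = tail (p ! Suc i)"
  using assms walk_head_nth unfolding thread_def path_def by metis

lemma thread_last:
  assumes "thread x p" "Suc i = length p"
  shows "head (p ! i) \<in> B"
  using assms walk_end walk_verts_Suc unfolding thread_def path_def by (metis lessI)

text \<open>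
  Going backwards from a common step, both threads run through the same predecessors until one of them,
  and hence the other, starts in \<open>A\<close>.
\<close>
lemma threads_disjoint:
  assumes p: "thread x p" and q: "thread y q" and xy: "tail x \<in> A" "tail y \<in> A"
  shows "i < length p \<Longrightarrow> p ! i \<in> set q \<Longrightarrow> x = y"
proof (induction i)
  case 0
  have hd: "p ! 0 = x" "q ! 0 = y" using p q by (auto simp: thread_def hd_conv_nth)
  from 0 obtain j where j: "j < length q" "q ! j = x" using hd by (auto simp: in_set_conv_nth)
  have "j = 0"
  proof (rule ccontr)
    assume "j \<noteq> 0"
    then obtain k where k: "j = Suc k" using not0_implies_Suc by blast
    have "head (q ! k) \<in> A" using thread_nth_Suc[OF q, of k] j k xy by simp
    then show False using head_notin thread_nth[OF q, of k] j k by auto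
  qed
  then show ?case using j hd by simp
next
  case (Suc i)
  then obtain j where j: "j < length q" "q ! j = p ! Suc i" by (auto simp: in_set_conv_nth)
  have hi: "head (p ! i) = tail (p ! Suc i)" "p ! i \<in> D"
    using thread_nth_Suc[OF p] thread_nth[OF p] Suc by auto
  have "j \<noteq> 0"
  proof
    assume "j = 0"
    then have "tail (p ! Suc i) \<in> A" using j q xy by (auto simp: thread_def hd_conv_nth)
    then show False using hi head_notin by fastforce
  qed
  then obtain k where k: "j = Suc k" using not0_implies_Suc by blast
  have "head (q ! k) = head (p ! i)" using thread_nth_Suc[OF q, of k] j k hi by simp
  moreover have "head (p ! i) \<notin> B"
    using hi tail_notin[OF thread_nth[OF p Suc.prems(1)]] by simp
  moreover have "q ! k \<in> D" using thread_nth[OF q] j k by simp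
  ultimately have "q ! k = p ! i" using head_inj hi by auto
  then show ?case using Suc j k by (metis Suc_lessD nth_mem)
qed

lemma threads_vertex_disjoint:
  assumes p: "thread x p" and q: "thread y q" and xy: "tail x \<in> A" "tail y \<in> A" "x \<noteq> y"
  shows "set (walk_verts (tail x) p) \<inter> set (walk_verts (tail y) q) \<subseteq> A \<union> B"
proof
  fix v assume v: "v \<in> set (walk_verts (tail x) p) \<inter> set (walk_verts (tail y) q)"
  show "v \<in> A \<union> B"
  proof (rule ccontr)
    assume nv: "v \<notin> A \<union> B"
    have step: "\<exists>j < length r. tail (r ! j) = v"
      if r: "thread z r" and z: "tail z \<in> A" and vr: "v \<in> set (walk_verts (tail z) r)" for z r
    proof -
      obtain i where i: "i < length r" "head (r ! i) = v"
        using vr nv z by (auto simp: set_walk_verts in_set_conv_nth)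
      then have "Suc i \<noteq> length r" using thread_last[OF r] nv by auto
      then have "Suc i < length r" using i by simp
      then show ?thesis using thread_nth_Suc[OF r] i by metis
    qed
    obtain i where i: "i < length p" "tail (p ! i) = v" using step[OF p xy(1)] v by auto
    obtain j where j: "j < length q" "tail (q ! j) = v" using step[OF q xy(2)] v by auto
    have "p ! i = q ! j" using tail_inj thread_nth p q i j nv by auto
    then show False using threads_disjoint[OF p q xy(1,2) i(1)] j xy by auto
  qed
qed

lemma thread_interior:
  assumes p: "thread x p" and xA: "tail x \<in> A" and b: "walk D (tail x) p b"
    and v: "v \<in> set (walk_verts (tail x) p)" "v \<noteq> tail x" "v \<noteq> b"
  shows "v \<notin> A \<union> B"
proof -
  obtain i where i: "i < length p" "head (p ! i) = v"
    using v by (auto simp: set_walk_verts in_set_conv_nth)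
  have "Suc i \<noteq> length p" using v i b walk_end walk_verts_Suc by metis
  then have "Suc i < length p" using i by simp
  then show ?thesis
    using thread_nth_Suc[OF p] thread_nth[OF p] i head_notin tail_notin
    by (metis UnE)
qed

definition "starts = {x \<in> D. tail x \<in> A}"

definition "chosen_thread x = (SOME p. thread x p)"

text \<open>
  What the threads leave over. By \<open>residue_pred\<close> and \<open>residue_succ\<close> these are the steps that lie
  on cycles.
\<close>
definition "residue = D - (\<Union>x \<in> starts. set (chosen_thread x))"

lemma chosen_thread: "x \<in> starts \<Longrightarrow> thread x (chosen_thread x)"
  unfolding chosen_thread_def starts_def using someI_ex[OF thread_exists] by simp

lemma finite_starts: "finite starts"
  using finite_steps by (simp add: starts_def)

lemma chosen_thread_inj: "inj_on chosen_thread starts"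
  by (rule inj_onI) (metis chosen_thread thread_def)

lemma chosen_thread_subset: "x \<in> starts \<Longrightarrow> set (chosen_thread x) \<subseteq> D"
  using thread_nth[OF chosen_thread, of x] by (metis in_set_conv_nth subsetI)

lemma chosen_threads_disjoint:
  assumes "x \<in> starts" "y \<in> starts" "z \<in> set (chosen_thread x)" "z \<in> set (chosen_thread y)"
  shows "x = y"
  using threads_disjoint[OF chosen_thread[OF assms(1)] chosen_thread[OF assms(2)]] assms
  by (auto simp: in_set_conv_nth starts_def)

lemma residue_tail:
  assumes "y \<in> residue" shows "tail y \<notin> A"
proof
  assume "tail y \<in> A"
  then have y: "y \<in> starts" using assms by (simp add: residue_def starts_def)
  then have "y \<in> set (chosen_thread y)" using chosen_thread[OF y] by (metis thread_def hd_in_set)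
  then show False using y assms by (auto simp: residue_def)
qed

lemma residue_pred:
  assumes y: "y \<in> residue"
  shows "\<exists>z \<in> residue. head z = tail y"
proof -
  have yD: "y \<in> D" using y by (simp add: residue_def)
  obtain z where z: "z \<in> D" "head z = tail y" using pred_ex[OF yD residue_tail[OF y]] by blast
  have "z \<notin> set (chosen_thread x)" if x: "x \<in> starts" for x
  proof
    assume "z \<in> set (chosen_thread x)"
    then obtain i where i: "i < length (chosen_thread x)" "chosen_thread x ! i = z"
      by (auto simp: in_set_conv_nth)
    note t = chosen_thread[OF x]
    have "Suc i \<noteq> length (chosen_thread x)"
      using thread_last[OF t, of i] i z tail_notin[OF yD] by auto
    then have i': "Suc i < length (chosen_thread x)" using i by simp
    have "chosen_thread x ! Suc i = y"
      using tail_inj[of y "chosen_thread x ! Suc i"] thread_nth_Suc[OF t i'] thread_nth[OF t i']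
        i z yD residue_tail[OF y] by simp
    then show False using y x i' nth_mem by (fastforce simp: residue_def)
  qed
  then show ?thesis using z by (auto simp: residue_def)
qed

text \<open>
  A step into \<open>B\<close> has no successor, so the point is that the residue never reaches \<open>B\<close>. Every step of
  the residue has a predecessor in it, and different steps have different ones; as the residue is
  finite, every step of it is therefore the predecessor of another one.
\<close>
lemma residue_succ:
  assumes y: "y \<in> residue"
  shows "\<exists>z \<in> residue. tail z = head y"
proof -
  define pr where "pr z = (SOME w. w \<in> residue \<and> head w = tail z)" for z :: "('v, 'e) step"
  have pr: "pr z \<in> residue \<and> head (pr z) = tail z" if "z \<in> residue" for z
    unfolding pr_def using someI_ex[of "\<lambda>w. w \<in> residue \<and> head w = tail z"] residue_pred[OF that]
    by blast
  have "inj_on pr residue"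
  proof (rule inj_onI)
    fix a b assume ab: "a \<in> residue" "b \<in> residue" "pr a = pr b"
    then have "tail a = tail b" using pr by metis
    then show "a = b" using ab tail_inj[of a b] residue_tail by (simp add: residue_def)
  qed
  moreover have "pr ` residue \<subseteq> residue" using pr by blast
  moreover have "finite residue" using finite_steps by (simp add: residue_def)
  ultimately have "pr ` residue = residue" using endo_inj_surj by blast
  then obtain z where "z \<in> residue" "y = pr z" using y by blast
  then show ?thesis using pr by metis
qed

lemma residue_head: "y \<in> residue \<Longrightarrow> head y \<notin> B"
  using residue_succ tail_notin by (fastforce simp: residue_def)

end

lemma linkageI:
  assumes fin: "finite D" and AB: "A \<inter> B = {}" and W: "W \<inter> (A \<union> B) = {}"
    and heads: "\<And>x. x \<in> D \<Longrightarrow> head x \<in> W \<union> B" and tails: "\<And>x. x \<in> D \<Longrightarrow> tail x \<in> W \<union> A"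
    and one_in: "\<And>v. v \<in> W \<Longrightarrow> \<exists>!x. x \<in> D \<and> head x = v"
    and one_out: "\<And>v. v \<in> W \<Longrightarrow> \<exists>!x. x \<in> D \<and> tail x = v"
  shows "linkage D A B"
proof
  show "head x \<notin> A" if "x \<in> D" for x using heads[OF that] AB W by blast
  show "tail x \<notin> B" if "x \<in> D" for x using tails[OF that] AB W by blast
  show "\<exists>y\<in>D. tail y = head x" if "x \<in> D" "head x \<notin> B" for x
    using heads[OF that(1)] that one_out by blast
  show "\<exists>y\<in>D. head y = tail x" if "x \<in> D" "tail x \<notin> A" for x
    using tails[OF that(1)] that one_in by blast
  show "x = y" if "x \<in> D" "y \<in> D" "tail x = tail y" "tail x \<notin> A" for x y
    using tails[OF that(1)] that one_out[of "tail x"] by (metis UnE)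
  show "x = y" if "x \<in> D" "y \<in> D" "head x = head y" "head x \<notin> B" for x y
    using heads[OF that(1)] that one_in[of "head x"] by (metis UnE)
qed (rule fin)

section \<open>Families of disjoint paths\<close>

lemma directed_steps_trav: "x \<in> directed_steps G \<longleftrightarrow> edge x \<in> edges G \<and> (tail x, head x) \<in> trav G (edge x)"
  by (cases x) (simp add: directed_steps_def)

locale path_family =
  fixes G :: "('v, 'e) network" and s r and \<phi> :: "('v, 'e) step list set"
  assumes loopless: "finite_loopless G"
    and source: "is_source G s" and sink: "is_sink G r" and ends_distinct: "s \<noteq> r"
    and disjoint: "disjoint_paths G s r \<phi>"
begin

abbreviation "D \<equiv> family_steps \<phi>"

lemma path: "p \<in> \<phi> \<Longrightarrow> path (directed_steps G) s p r"
  using disjoint by (simp add: disjoint_paths_def)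

lemma path_walk: "p \<in> \<phi> \<Longrightarrow> walk (directed_steps G) s p r"
  using path by (simp add: path_def)

lemma step_directed: "x \<in> D \<Longrightarrow> x \<in> directed_steps G"
  using walk_subset[OF path_walk] by (auto simp: family_steps_def)

lemma step_at:
  assumes "x \<in> D"
  obtains p i where "p \<in> \<phi>" "i < length p" "p ! i = x"
    "walk_verts s p ! i = tail x" "walk_verts s p ! Suc i = head x"
proof -
  obtain p i where p: "p \<in> \<phi>" "i < length p" "p ! i = x"
    using assms by (auto simp: family_steps_def in_set_conv_nth)
  show ?thesis
    using that[OF p] walk_tail_nth[OF path_walk[OF p(1)] p(2)] walk_verts_Suc[OF p(2)] p(3) by simp
qed

lemma finite_D: "finite D"
  using disjoint by (simp add: family_steps_def disjoint_paths_def)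

lemma step_edge:
  assumes "x \<in> D"
  shows "edge x \<in> edges G" "(tail x, head x) \<in> trav G (edge x)" "tail x \<noteq> head x"
    "ends G (edge x) = {tail x, head x}" "tail x \<in> verts G" "head x \<in> verts G"
proof -
  show e: "edge x \<in> edges G" and t: "(tail x, head x) \<in> trav G (edge x)"
    using step_directed[OF assms] by (auto simp: directed_steps_trav)
  have *: "directed_edge G (edge x) \<or> undirected_edge G (edge x)" "ends G (edge x) \<subseteq> verts G"
    using loopless e by (auto simp: finite_loopless_def)
  then show "tail x \<noteq> head x" "ends G (edge x) = {tail x, head x}"
    using t by (auto simp: directed_edge_def undirected_edge_def ends_def Field_def)
  then show "tail x \<in> verts G" "head x \<in> verts G" using * by auto
qed

text \<open>
  This and the next lemma are applied to the source and the sink of the other family, too.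
\<close>
lemma head_not_source:
  assumes x: "x \<in> D" and t: "is_source G t" shows "head x \<noteq> t"
proof
  assume h: "head x = t"
  then have "t \<in> ends G (edge x)" using step_edge[OF x] by simp
  then obtain v where "trav G (edge x) = {(t, v)}"
    using t step_edge(1)[OF x] by (auto simp: is_source_def)
  then show False using step_edge(2,3)[OF x] h by auto
qed

lemma tail_not_sink:
  assumes x: "x \<in> D" and t: "is_sink G t" shows "tail x \<noteq> t"
proof
  assume h: "tail x = t"
  then have "t \<in> ends G (edge x)" using step_edge[OF x] by simp
  then obtain v where "trav G (edge x) = {(v, t)}"
    using t step_edge(1)[OF x] by (auto simp: is_sink_def)
  then show False using step_edge(2,3)[OF x] h by auto
qed

lemma same_path:
  assumes "p \<in> \<phi>" "q \<in> \<phi>" "i \<le> length p" "j \<le> length q"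
    "walk_verts s p ! i = v" "walk_verts s q ! j = v" "v \<noteq> s" "v \<noteq> r"
  shows "p = q \<and> i = j"
proof -
  have "v \<in> set (walk_verts s p)" "v \<in> set (walk_verts s q)"
    using assms by (metis le_imp_less_Suc length_walk_verts nth_mem)+
  then have "p = q" using assms disjoint unfolding disjoint_paths_def by blast
  moreover have "i = j"
    by (rule path_position_unique[OF path[OF assms(1)]]) (use assms \<open>p = q\<close> in auto)
  ultimately show ?thesis by simp
qed

lemma linkage: "linkage D {s} {r}"
proof
  show "finite D" by (rule finite_D)
  show "head x \<notin> {s}" if "x \<in> D" for x using head_not_source[OF that source] by simp
  show "tail x \<notin> {r}" if "x \<in> D" for x using tail_not_sink[OF that sink] by simp
  show "\<exists>y\<in>D. tail y = head x" if x: "x \<in> D" "head x \<notin> {r}" for x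
  proof -
    obtain p i where p: "p \<in> \<phi>" "i < length p" "walk_verts s p ! Suc i = head x"
      using step_at[OF x(1)] by metis
    then have "Suc i \<noteq> length p" using walk_end[OF path_walk] x by auto
    then have "Suc i < length p" using p by simp
    then show ?thesis using p walk_tail_nth[OF path_walk] unfolding family_steps_def
      by (metis UN_I nth_mem)
  qed
  show "\<exists>y\<in>D. head y = tail x" if x: "x \<in> D" "tail x \<notin> {s}" for x
  proof -
    obtain p i where p: "p \<in> \<phi>" "i < length p" "walk_verts s p ! i = tail x"
      using step_at[OF x(1)] by metis
    then obtain j where "i = Suc j" using x by (cases i) auto
    then show ?thesis using p walk_verts_Suc unfolding family_steps_def
      by (metis UN_I nth_mem Suc_lessD)
  qed
  show "x = y" if xy: "x \<in> D" "y \<in> D" "tail x = tail y" "tail x \<notin> {s}" for x y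
  proof -
    obtain p i where p: "p \<in> \<phi>" "i < length p" "p ! i = x" "walk_verts s p ! i = tail x"
      using step_at[OF xy(1)] by metis
    obtain q j where q: "q \<in> \<phi>" "j < length q" "q ! j = y" "walk_verts s q ! j = tail y"
      using step_at[OF xy(2)] by metis
    have "p = q \<and> i = j"
      by (rule same_path[of p q i j "tail x"])
        (use p q xy tail_not_sink[OF xy(1) sink] in auto)
    then show ?thesis using p q by auto
  qed
  show "x = y" if xy: "x \<in> D" "y \<in> D" "head x = head y" "head x \<notin> {r}" for x y
  proof -
    obtain p i where p: "p \<in> \<phi>" "i < length p" "p ! i = x" "walk_verts s p ! Suc i = head x"
      using step_at[OF xy(1)] by metis
    obtain q j where q: "q \<in> \<phi>" "j < length q" "q ! j = y" "walk_verts s q ! Suc j = head y"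
      using step_at[OF xy(2)] by metis
    have "p = q \<and> Suc i = Suc j"
      by (rule same_path[of p q "Suc i" "Suc j" "head x"])
        (use p q xy head_not_source[OF xy(1) source] in auto)
    then show ?thesis using p q by auto
  qed
qed

sublocale linkage D "{s}" "{r}" by (rule linkage)

lemma tail_not_other_source:
  assumes "x \<in> D" "is_source G t" "t \<noteq> s" shows "tail x \<noteq> t"
  using pred_ex[OF assms(1)] head_not_source assms by blast

lemma head_not_other_sink:
  assumes "x \<in> D" "is_sink G t" "t \<noteq> r" shows "head x \<noteq> t"
  using succ_ex[OF assms(1)] tail_not_sink assms by blast

text \<open>
  An undirected edge traversed both ways would make one of the paths return to the vertex it came
  from.
\<close>
lemma edge_inj:
  assumes x: "x \<in> D" and y: "y \<in> D" and e: "edge x = edge y"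
  shows "x = y"
proof (cases "tail x = tail y")
  case True
  then have "head x = head y" using step_edge(3,4)[OF x] step_edge(3,4)[OF y] e
    by (metis doubleton_eq_iff)
  then show ?thesis using True e by (simp add: prod_eq_iff)
next
  case False
  then have h: "tail y = head x" "head y = tail x"
    using step_edge(4)[OF x] step_edge(4)[OF y] e by (auto simp: doubleton_eq_iff)
  obtain p i where p: "p \<in> \<phi>" "i < length p" "walk_verts s p ! i = tail x"
    "walk_verts s p ! Suc i = head x" using step_at[OF x] by metis
  obtain q j where q: "q \<in> \<phi>" "j < length q" "walk_verts s q ! j = tail y"
    "walk_verts s q ! Suc j = head y" using step_at[OF y] by metis
  have "p = q \<and> i = Suc j"
    by (rule same_path[of p q i "Suc j" "tail x"])
      (use p q h tail_not_sink[OF x sink] head_not_source[OF y source] in auto)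
  moreover have "p = q \<and> Suc i = j"
    by (rule same_path[of p q "Suc i" j "head x"])
      (use p q h tail_not_sink[OF y sink] head_not_source[OF x source] in auto)
  ultimately show ?thesis by simp
qed

text \<open>
  The delicate case is a step directly from \<open>s\<close> to \<open>r\<close>, the only kind without an inner vertex: there
  the whole path consists of this step.
\<close>
lemma step_path_unique:
  assumes p: "p \<in> \<phi>" "x \<in> set p" and q: "q \<in> \<phi>" "x \<in> set q"
  shows "p = q"
proof -
  obtain i where i: "i < length p" "p ! i = x" using p by (auto simp: in_set_conv_nth)
  obtain j where j: "j < length q" "q ! j = x" using q by (auto simp: in_set_conv_nth)
  have at: "walk_verts s p ! i = tail x" "walk_verts s q ! j = tail x"
     "walk_verts s p ! Suc i = head x" "walk_verts s q ! Suc j = head x"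
    using i j walk_tail_nth[OF path_walk[OF p(1)] i(1)] walk_tail_nth[OF path_walk[OF q(1)] j(1)]
    by (simp_all add: walk_verts_Suc)
  have xD: "x \<in> D" using p by (auto simp: family_steps_def)
  show ?thesis
  proof (cases "tail x = s \<and> head x = r")
    case False
    then consider "tail x \<noteq> s" | "head x \<noteq> r" by blast
    then show ?thesis
    proof cases
      case 1
      have "p = q \<and> i = j"
        by (rule same_path[of p q i j "tail x"])
          (use 1 at(1,2) i(1) j(1) p(1) q(1) tail_not_sink[OF xD sink] in auto)
      then show ?thesis by simp
    next
      case 2
      have "p = q \<and> Suc i = Suc j"
        by (rule same_path[of p q "Suc i" "Suc j" "head x"])
          (use 2 at(3,4) i(1) j(1) p(1) q(1) head_not_source[OF xD source] in auto)
      then show ?thesis by simp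
    qed
  next
    case True
    have single: "u = [x]" if u: "u \<in> \<phi>" and k: "k < length u" "u ! k = x"
      "walk_verts s u ! k = tail x" "walk_verts s u ! Suc k = head x" for u k
    proof -
      have "k = 0" by (rule path_position_unique[OF path[OF u]]) (use k True in auto)
      moreover have "Suc k = length u"
        by (rule path_position_unique[OF path[OF u]])
          (use k True walk_end[OF path_walk[OF u]] in auto)
      ultimately show ?thesis using k by (cases u) auto
    qed
    show ?thesis using single[OF p(1) i] single[OF q(1) j] at by simp
  qed
qed

lemma path_nonempty: "p \<in> \<phi> \<Longrightarrow> p \<noteq> []"
  using path_walk ends_distinct by fastforce

lemma card_out_source: "card {x \<in> D. tail x = s} = card \<phi>"
proof -
  have "bij_betw hd \<phi> {x \<in> D. tail x = s}"
  proof (rule bij_betw_imageI)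
    show "inj_on hd \<phi>"
      by (rule inj_onI) (metis path_nonempty step_path_unique list.set_sel(1))
    have "hd p \<in> D \<and> tail (hd p) = s" if p: "p \<in> \<phi>" for p
      using path_nonempty[OF p] walk_tail_nth[OF path_walk[OF p], of 0] p
      by (auto simp: family_steps_def hd_conv_nth intro!: bexI[of _ p])
    moreover have "x \<in> hd ` \<phi>" if x: "x \<in> D" "tail x = s" for x
    proof -
      obtain p i where p: "p \<in> \<phi>" "i < length p" "p ! i = x" "walk_verts s p ! i = tail x"
        using step_at[OF x(1)] by metis
      have "i = 0"
        by (rule path_position_unique[OF path[OF p(1)]]) (use p(2,4) x(2) in auto)
      then have "hd p = x" using p path_nonempty[OF p(1)] by (simp add: hd_conv_nth)
      then show ?thesis using p(1) by blast
    qed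
    ultimately show "hd ` \<phi> = {x \<in> D. tail x = s}" by blast
  qed
  then show ?thesis by (simp add: bij_betw_same_card)
qed

lemma card_into_sink: "card {x \<in> D. head x = r} = card \<phi>"
proof -
  have "bij_betw last \<phi> {x \<in> D. head x = r}"
  proof (rule bij_betw_imageI)
    show "inj_on last \<phi>"
      by (rule inj_onI) (metis path_nonempty step_path_unique last_in_set)
    have "last p \<in> D \<and> head (last p) = r" if p: "p \<in> \<phi>" for p
    proof
      show "last p \<in> D" using path_nonempty[OF p] p by (auto simp: family_steps_def intro!: bexI[of _ p])
      show "head (last p) = r"
        using path_nonempty[OF p] walk_end[OF path_walk[OF p]] walk_verts_Suc[of "length p - 1" p s]
        by (simp add: last_conv_nth)
    qed
    moreover have "x \<in> last ` \<phi>" if x: "x \<in> D" "head x = r" for x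
    proof -
      obtain p i where p: "p \<in> \<phi>" "i < length p" "p ! i = x" "walk_verts s p ! Suc i = head x"
        using step_at[OF x(1)] by metis
      have "Suc i = length p"
        by (rule path_position_unique[OF path[OF p(1)]])
          (use p(2,4) x(2) walk_end[OF path_walk[OF p(1)]] in auto)
      then have "last p = x" using p(3) path_nonempty[OF p(1)] by (metis diff_Suc_1 last_conv_nth)
      then show ?thesis using p(1) by blast
    qed
    ultimately show "last ` \<phi> = {x \<in> D. head x = r}" by blast
  qed
  then show ?thesis by (simp add: bij_betw_same_card)
qed

end

context path_family
begin

text \<open>
  The dichotomy behind the degree count: a family uses no edge at an inner vertex or exactly two.
\<close>
lemma edges_at:
  assumes "v \<noteq> s" "v \<noteq> r"
  shows "{e \<in> family_edges \<phi>. v \<in> ends G e} = {} \<or>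
    (\<exists>x \<in> D. \<exists>y \<in> D. head x = v \<and> tail y = v \<and> edge x \<noteq> edge y \<and>
       {e \<in> family_edges \<phi>. v \<in> ends G e} = {edge x, edge y})"
proof (rule disjCI)
  assume "\<not> (\<exists>x \<in> D. \<exists>y \<in> D. head x = v \<and> tail y = v \<and> edge x \<noteq> edge y \<and>
       {e \<in> family_edges \<phi>. v \<in> ends G e} = {edge x, edge y})"
  moreover have "\<exists>x \<in> D. \<exists>y \<in> D. head x = v \<and> tail y = v \<and> edge x \<noteq> edge y \<and>
       {e \<in> family_edges \<phi>. v \<in> ends G e} = {edge x, edge y}"
    if e: "e \<in> family_edges \<phi>" "v \<in> ends G e" for e
  proof -
    obtain z where z: "z \<in> D" "tail z = v \<or> head z = v"
      using e step_edge(4) by (fastforce simp: family_edges_eq_image)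
    then have "(\<exists>x \<in> D. head x = v) \<and> (\<exists>y \<in> D. tail y = v)"
      using pred_ex[OF z(1)] succ_ex[OF z(1)] assms by blast
    then obtain x y where x: "x \<in> D" "head x = v" and y: "y \<in> D" "tail y = v" by blast
    have "edge x \<noteq> edge y" using edge_inj[OF x(1) y(1)] step_edge(3)[OF x(1)] x y by auto
    moreover have "{e \<in> family_edges \<phi>. v \<in> ends G e} = {edge x, edge y}"
    proof (intro equalityI subsetI)
      fix f assume "f \<in> {e \<in> family_edges \<phi>. v \<in> ends G e}"
      then obtain w where w: "w \<in> D" "edge w = f" "tail w = v \<or> head w = v"
        using step_edge(4) by (fastforce simp: family_edges_eq_image)
      then have "w = x \<or> w = y"
        using head_inj[OF w(1) x(1)] tail_inj[OF w(1) y(1)] x y assms by auto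
      then show "f \<in> {edge x, edge y}" using w by auto
    qed (use x y step_edge(4)[OF x(1)] step_edge(4)[OF y(1)] in \<open>auto simp: family_edges_eq_image\<close>)
    ultimately show ?thesis using x y by blast
  qed
  ultimately show "{e \<in> family_edges \<phi>. v \<in> ends G e} = {}" by blast
qed

end

text \<open>
  Threads between two single vertices are disjoint paths; cycles among the steps are simply left
  out.
\<close>
lemma linkage_disjoint_paths:
  assumes "linkage D {s} {r}" and sub: "D \<subseteq> directed_steps G"
  obtains \<phi> where "disjoint_paths G s r \<phi>" "card \<phi> = card {x \<in> D. tail x = s}" "family_steps \<phi> \<subseteq> D"
proof -
  interpret L: linkage D "{s}" "{r}" by fact
  have st: "tail x = s" if "x \<in> L.starts" for x using that by (simp add: L.starts_def)
  have "path (directed_steps G) s (L.chosen_thread x) r" if x: "x \<in> L.starts" for x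
    using L.chosen_thread[OF x] L.chosen_thread_subset[OF x] sub st[OF x] walk_mono
    unfolding L.thread_def path_def by (metis singletonD subset_trans)
  moreover have "set (walk_verts s p) \<inter> set (walk_verts s q) \<subseteq> {s, r}"
    if pq: "p \<in> L.chosen_thread ` L.starts" "q \<in> L.chosen_thread ` L.starts" "p \<noteq> q" for p q
  proof -
    obtain x y where xy: "x \<in> L.starts" "y \<in> L.starts" "x \<noteq> y"
      "p = L.chosen_thread x" "q = L.chosen_thread y" using pq by blast
    show ?thesis
      using L.threads_vertex_disjoint[OF L.chosen_thread[OF xy(1)] L.chosen_thread[OF xy(2)]]
        st[OF xy(1)] st[OF xy(2)] xy by (simp add: insert_commute)
  qed
  ultimately have "disjoint_paths G s r (L.chosen_thread ` L.starts)"
    using L.finite_starts by (auto simp: disjoint_paths_def)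
  moreover have "card (L.chosen_thread ` L.starts) = card {x \<in> D. tail x = s}"
    using card_image[OF L.chosen_thread_inj] by (simp add: L.starts_def)
  moreover have "family_steps (L.chosen_thread ` L.starts) \<subseteq> D"
    using L.chosen_thread_subset by (auto simp: family_steps_def)
  ultimately show ?thesis using that by blast
qed

section \<open>Two covering families in a cubic network\<close>

text \<open>
  The four terminals are parameters, independent of their roles in \<open>G\<close>, so that the two families can
  be exchanged.
\<close>
locale cubic_pair =
  fixes G :: "('v, 'e) network" and s1 r1 s2 r2 and \<phi> \<psi> :: "('v, 'e) step list set"
  assumes first: "path_family G s1 r1 \<phi>" and second: "path_family G s2 r2 \<psi>"
    and terminals_distinct: "distinct [s1, s2, r1, r2]"
    and cover: "edges G = family_edges \<phi> \<union> family_edges \<psi>"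
    and cubic: "v \<in> verts G - {s1, s2, r1, r2} \<Longrightarrow> degree G v = 3"
begin

sublocale F: path_family G s1 r1 \<phi> by (rule first)
sublocale S: path_family G s2 r2 \<psi> by (rule second)

abbreviation "inner \<equiv> verts G - {s1, s2, r1, r2}"

lemma swap: "cubic_pair G s2 r2 s1 r1 \<psi> \<phi>"
  using first second terminals_distinct cover cubic
  by (intro cubic_pair.intro) (auto simp: insert_commute)

lemma first_tail: "x \<in> F.D \<Longrightarrow> tail x \<in> insert s1 inner"
  using F.tail_not_other_source[of x s2] F.tail_not_sink[of x] F.step_edge(5)[of x]
    S.source S.sink F.sink terminals_distinct by auto

lemma first_head: "x \<in> F.D \<Longrightarrow> head x \<in> insert r1 inner"
  using F.head_not_other_sink[of x r2] F.head_not_source[of x] F.step_edge(6)[of x]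
    S.source S.sink F.source terminals_distinct by auto

text \<open>
  Two plus two edges cover a total of three, so exactly one of them is common. The two equivalences
  express this once from the view of each family.
\<close>
lemma at_vertex:
  assumes v: "v \<in> inner"
  obtains x y x' y' where
    "x \<in> F.D" "y \<in> F.D" "head x = v" "tail y = v"
    "x' \<in> S.D" "y' \<in> S.D" "head x' = v" "tail y' = v"
    "edge x \<in> family_edges \<psi> \<longleftrightarrow> edge y \<notin> family_edges \<psi>"
    "edge x' \<in> family_edges \<phi> \<longleftrightarrow> edge y' \<notin> family_edges \<phi>"
proof -
  let ?E = "\<lambda>\<phi>. {e \<in> family_edges \<phi>. v \<in> ends G e}"
  have "{e \<in> edges G. v \<in> ends G e} = ?E \<phi> \<union> ?E \<psi>" using cover by auto
  then have three: "card (?E \<phi> \<union> ?E \<psi>) = 3" using cubic[OF v] by (simp add: degree_def)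
  have F: "?E \<phi> = {} \<or> (\<exists>x \<in> F.D. \<exists>y \<in> F.D. head x = v \<and> tail y = v \<and> edge x \<noteq> edge y \<and>
       ?E \<phi> = {edge x, edge y})" using v by (intro F.edges_at) auto
  have S: "?E \<psi> = {} \<or> (\<exists>x \<in> S.D. \<exists>y \<in> S.D. head x = v \<and> tail y = v \<and> edge x \<noteq> edge y \<and>
       ?E \<psi> = {edge x, edge y})" using v by (intro S.edges_at) auto
  have two: "card X \<le> 2" if "X = {} \<or> (\<exists>a b. X = {a, b})" for X :: "'e set"
    using that by (auto simp: card_insert_if)
  have "card (?E \<phi>) \<le> 2" "card (?E \<psi>) \<le> 2" using two F S by blast+
  then have "?E \<phi> \<noteq> {}" "?E \<psi> \<noteq> {}"
    using three by (auto simp del: Collect_empty_eq)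
  then obtain x y where x: "x \<in> F.D" "y \<in> F.D" "head x = v" "tail y = v" "edge x \<noteq> edge y"
    and Ex: "?E \<phi> = {edge x, edge y}"
    using F by blast
  obtain x' y' where x': "x' \<in> S.D" "y' \<in> S.D" "head x' = v" "tail y' = v" "edge x' \<noteq> edge y'"
    and Ex': "?E \<psi> = {edge x', edge y'}"
    using S \<open>?E \<psi> \<noteq> {}\<close> by blast
  have mem: "edge x \<in> family_edges \<psi> \<longleftrightarrow> edge x \<in> {edge x', edge y'}"
    "edge y \<in> family_edges \<psi> \<longleftrightarrow> edge y \<in> {edge x', edge y'}"
    "edge x' \<in> family_edges \<phi> \<longleftrightarrow> edge x' \<in> {edge x, edge y}"
    "edge y' \<in> family_edges \<phi> \<longleftrightarrow> edge y' \<in> {edge x, edge y}"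
    using Ex Ex' by blast+
  have "card ({edge x, edge y} \<union> {edge x', edge y'}) = 3" using three unfolding Ex Ex' .
  then have "card ({edge x, edge y} \<inter> {edge x', edge y'}) = 1"
    using card_Un_Int[of "{edge x, edge y}" "{edge x', edge y'}"] x(5) x'(5) by simp
  then obtain e where e: "{edge x, edge y} \<inter> {edge x', edge y'} = {e}"
    by (rule card_1_singletonE)
  have "(a \<in> {c, d} \<longleftrightarrow> b \<notin> {c, d}) \<and> (c \<in> {a, b} \<longleftrightarrow> d \<notin> {a, b})"
    if "{a, b} \<inter> {c, d} = {e}" "a \<noteq> b" "c \<noteq> d" for a b c d :: 'e
  proof -
    have "(z = a \<or> z = b) \<and> (z = c \<or> z = d) \<longleftrightarrow> z = e" for z
      using that(1) by (metis Int_iff insert_iff singletonD singletonI)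
    then show ?thesis using that(2,3) unfolding insert_iff empty_iff by metis
  qed
  note this[OF e x(5) x'(5)]
  then show ?thesis using that[of x y x' y'] x x' mem by blast
qed

text \<open>
  The first edge is private since it meets the second source, and at each later vertex exactly one of
  two consecutive edges is shared.
\<close>
lemma shared_iff_odd:
  assumes p: "p \<in> \<psi>"
  shows "i < length p \<Longrightarrow> edge (p ! i) \<in> family_edges \<phi> \<longleftrightarrow> odd i"
proof (induction i)
  case 0
  have t: "tail (p ! 0) = s2" using walk_tail_nth[OF S.path_walk[OF p] 0] by simp
  have "p ! 0 \<in> S.D" using p 0 by (auto simp: family_steps_def intro!: bexI[of _ p])
  then have e: "s2 \<in> ends G (edge (p ! 0))" using S.step_edge(4) t by simp
  have "edge (p ! 0) \<notin> family_edges \<phi>"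
  proof
    assume "edge (p ! 0) \<in> family_edges \<phi>"
    then obtain z where z: "z \<in> F.D" "edge z = edge (p ! 0)" by (auto simp: family_edges_eq_image)
    then have "s2 = tail z \<or> s2 = head z" using F.step_edge(4)[OF z(1)] e by simp
    then show False using first_tail[OF z(1)] first_head[OF z(1)] terminals_distinct by auto
  qed
  then show ?case by simp
next
  case (Suc i)
  have D: "p ! i \<in> S.D" "p ! Suc i \<in> S.D"
    using p Suc.prems by (auto simp: family_steps_def intro!: bexI[of _ p])
  have h: "head (p ! i) = tail (p ! Suc i)" using walk_head_nth[OF S.path_walk[OF p] Suc.prems] .
  interpret sw: cubic_pair G s2 r2 s1 r1 \<psi> \<phi> by (rule swap)
  have v: "head (p ! i) \<in> inner" using sw.first_head[OF D(1)] sw.first_tail[OF D(2)] h terminals_distinct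
    by auto
  obtain x' y' where xy: "x' \<in> S.D" "y' \<in> S.D" "head x' = head (p ! i)" "tail y' = head (p ! i)"
    "edge x' \<in> family_edges \<phi> \<longleftrightarrow> edge y' \<notin> family_edges \<phi>" using at_vertex[OF v] by metis
  have "x' = p ! i" by (rule S.head_inj[OF xy(1) D(1)]) (use xy(3) v in auto)
  moreover have "y' = p ! Suc i" by (rule S.tail_inj[OF xy(2) D(2)]) (use xy(4) v h in auto)
  moreover have "edge (p ! i) \<in> family_edges \<phi> \<longleftrightarrow> odd i" using Suc.IH Suc.prems by simp
  ultimately show ?case using xy(5) by (metis even_Suc)
qed

end

lemma family_edges_unique:
  assumes "cubic_pair G s1 r1 s2 r2 \<phi> \<psi>" "cubic_pair G s1 r1 s2 r2 \<phi>' \<psi>"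
  shows "family_edges \<phi> = family_edges \<phi>'"
proof -
  have "family_edges \<phi> \<subseteq> family_edges \<phi>'"
    if a: "cubic_pair G s1 r1 s2 r2 \<phi> \<psi>" and b: "cubic_pair G s1 r1 s2 r2 \<phi>' \<psi>" for \<phi> \<phi>'
  proof
    fix e assume e: "e \<in> family_edges \<phi>"
    show "e \<in> family_edges \<phi>'"
    proof (cases "e \<in> family_edges \<psi>")
      case False
      then show ?thesis using e cubic_pair.cover[OF a] cubic_pair.cover[OF b] by blast
    next
      case True
      then obtain p i where p: "p \<in> \<psi>" "i < length p" "edge (p ! i) = e"
        by (auto simp: family_edges_eq_image family_steps_def in_set_conv_nth)
      then show ?thesis
        using cubic_pair.shared_iff_odd[OF a p(1,2)] cubic_pair.shared_iff_odd[OF b p(1,2)] e by simp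
    qed
  qed
  then show ?thesis using assms by blast
qed

section \<open>The alternating linkage\<close>

text \<open>
  The same edge traversed in the opposite direction.
\<close>
definition flip :: "('v, 'e) step \<Rightarrow> ('v, 'e) step" where
  "flip x = (head x, edge x, tail x)"

lemma flip_sel [simp]: "tail (flip x) = head x" "head (flip x) = tail x" "edge (flip x) = edge x"
  "flip (flip x) = x"
  by (auto simp: flip_def)

lemma flip_eq_iff [simp]: "flip x = flip y \<longleftrightarrow> x = y"
  by (metis flip_sel(4))

text \<open>
  Orientation is required from \<open>\<phi>\<close> to \<open>\<psi>\<close> only; the converse follows since a step of a family is
  determined by its edge. The last assumption is the part of minimality that the exclusion of cycles
  needs.
\<close>
locale oriented_cubic_pair = cubic_pair G s1 r1 s2 r2 \<phi> \<psi>
  for G :: "('v, 'e) network" and s1 r1 s2 r2 \<phi> \<psi> +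
  assumes oriented: "x \<in> F.D \<Longrightarrow> edge x \<in> family_edges \<psi> \<Longrightarrow> x \<in> S.D"
    and irredundant: "disjoint_paths G s1 r1 \<phi>' \<Longrightarrow> card \<phi>' = card \<phi> \<Longrightarrow>
      edges G = family_edges \<phi>' \<union> family_edges \<psi>"
begin

lemma first_edge: "x \<in> F.D \<Longrightarrow> edge x \<in> family_edges \<phi>"
  by (simp add: family_edges_eq_image)

lemma second_edge: "x \<in> S.D \<Longrightarrow> edge x \<in> family_edges \<psi>"
  by (simp add: family_edges_eq_image)

lemma second_tail: "x \<in> S.D \<Longrightarrow> tail x \<in> insert s2 inner"
  using cubic_pair.first_tail[OF swap, of x] by auto

lemma second_head: "x \<in> S.D \<Longrightarrow> head x \<in> insert r2 inner"
  using cubic_pair.first_head[OF swap, of x] by auto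

text \<open>
  Private edges of \<open>\<phi>\<close> traversed forwards and private edges of \<open>\<psi>\<close> traversed backwards.
\<close>
definition alternation :: "('v, 'e) step set" where
  "alternation = {x \<in> F.D. edge x \<notin> family_edges \<psi>} \<union>
     {x. flip x \<in> S.D \<and> edge x \<notin> family_edges \<phi>}"

text \<open>
  The shared edge at \<open>v\<close> has the same direction in both families: they merge at \<open>v\<close> if it is outgoing
  and split if it is incoming.
\<close>
lemma vertex_cases:
  assumes v: "v \<in> inner"
  obtains (merge) x x' y where "x \<in> F.D" "x' \<in> S.D" "y \<in> F.D" "y \<in> S.D"
      "head x = v" "head x' = v" "tail y = v"
      "edge x \<notin> family_edges \<psi>" "edge x' \<notin> family_edges \<phi>"
  | (split) x y y' where "x \<in> F.D" "x \<in> S.D" "y \<in> F.D" "y' \<in> S.D"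
      "head x = v" "tail y = v" "tail y' = v"
      "edge y \<notin> family_edges \<psi>" "edge y' \<notin> family_edges \<phi>"
proof -
  obtain x y x' y' where D: "x \<in> F.D" "y \<in> F.D" "x' \<in> S.D" "y' \<in> S.D"
    and at: "head x = v" "tail y = v" "head x' = v" "tail y' = v"
    and xy: "edge x \<in> family_edges \<psi> \<longleftrightarrow> edge y \<notin> family_edges \<psi>"
    and xy': "edge x' \<in> family_edges \<phi> \<longleftrightarrow> edge y' \<notin> family_edges \<phi>" using at_vertex[OF v] by metis
  show ?thesis
  proof (cases "edge x \<in> family_edges \<psi>")
    case True
    note xS = oriented[OF D(1) True]
    have "x' = x" by (rule S.head_inj[OF D(3) xS]) (use at v in auto)
    then have "edge y' \<notin> family_edges \<phi>" using xy' first_edge[OF D(1)] by simp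
    moreover have "edge y \<notin> family_edges \<psi>" using xy True by simp
    ultimately show ?thesis using split[OF D(1) xS D(2,4) at(1,2,4)] by simp
  next
    case False
    then have ye: "edge y \<in> family_edges \<psi>" using xy by simp
    note yS = oriented[OF D(2) ye]
    have "y' = y" by (rule S.tail_inj[OF D(4) yS]) (use at v in auto)
    then have "edge x' \<notin> family_edges \<phi>" using xy' first_edge[OF D(2)] by simp
    then show ?thesis using merge[OF D(1,3,2) yS at(1,3,2) False] by simp
  qed
qed

text \<open>
  Where the families merge, an alternating path arrives on \<open>\<phi>\<close> and goes back on \<open>\<psi>\<close>; where they
  split, it arrives backwards on \<open>\<psi>\<close> and proceeds on \<open>\<phi>\<close>.
\<close>
lemma alternation_cases:
  assumes v: "v \<in> inner"
  obtains (merge) x x' y where "x \<in> F.D" "x' \<in> S.D" "y \<in> F.D" "y \<in> S.D"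
      "head x = v" "head x' = v" "tail y = v" "x \<in> alternation" "flip x' \<in> alternation"
      "\<And>z. z \<in> alternation \<Longrightarrow> head z = v \<Longrightarrow> z = x"
      "\<And>z. z \<in> alternation \<Longrightarrow> tail z = v \<Longrightarrow> z = flip x'"
  | (split) x y y' where "x \<in> F.D" "x \<in> S.D" "y \<in> F.D" "y' \<in> S.D"
      "head x = v" "tail y = v" "tail y' = v" "y \<in> alternation" "flip y' \<in> alternation"
      "\<And>z. z \<in> alternation \<Longrightarrow> head z = v \<Longrightarrow> z = flip y'"
      "\<And>z. z \<in> alternation \<Longrightarrow> tail z = v \<Longrightarrow> z = y"
  using v
proof (cases rule: vertex_cases)
  case m: (merge x x' y)
  have "z = x" if z: "z \<in> alternation" "head z = v" for z
  proof -
    have "z \<in> F.D"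
    proof (rule ccontr)
      assume "z \<notin> F.D"
      then have f: "flip z \<in> S.D" "edge z \<notin> family_edges \<phi>" using z by (auto simp: alternation_def)
      have "flip z = y" by (rule S.tail_inj[OF f(1) m(4)]) (use z(2) m(7) v in auto)
      then show False using f(2) first_edge[OF m(3)] by (metis flip_sel(3))
    qed
    then show ?thesis by (rule F.head_inj[OF _ m(1)]) (use z(2) m(5) v in auto)
  qed
  moreover have "z = flip x'" if z: "z \<in> alternation" "tail z = v" for z
  proof -
    have f: "flip z \<in> S.D"
    proof (rule ccontr)
      assume "flip z \<notin> S.D"
      then have f: "z \<in> F.D" "edge z \<notin> family_edges \<psi>" using z by (auto simp: alternation_def)
      have "z = y" by (rule F.tail_inj[OF f(1) m(3)]) (use z(2) m(7) v in auto)
      then show False using f(2) second_edge[OF m(4)] by simp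
    qed
    have "flip z = x'" by (rule S.head_inj[OF f m(2)]) (use z(2) m(6) v in auto)
    then show ?thesis by (metis flip_sel(4))
  qed
  moreover have "x \<in> alternation" "flip x' \<in> alternation"
    using m(1,2,8,9) by (simp_all add: alternation_def)
  ultimately show ?thesis using merge[OF m(1-7)] by blast
next
  case m: (split x y y')
  have "z = y" if z: "z \<in> alternation" "tail z = v" for z
  proof -
    have "z \<in> F.D"
    proof (rule ccontr)
      assume "z \<notin> F.D"
      then have f: "flip z \<in> S.D" "edge z \<notin> family_edges \<phi>" using z by (auto simp: alternation_def)
      have "flip z = x" by (rule S.head_inj[OF f(1) m(2)]) (use z(2) m(5) v in auto)
      then show False using f(2) first_edge[OF m(1)] by (metis flip_sel(3))
    qed
    then show ?thesis by (rule F.tail_inj[OF _ m(3)]) (use z(2) m(6) v in auto)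
  qed
  moreover have "z = flip y'" if z: "z \<in> alternation" "head z = v" for z
  proof -
    have f: "flip z \<in> S.D"
    proof (rule ccontr)
      assume "flip z \<notin> S.D"
      then have f: "z \<in> F.D" "edge z \<notin> family_edges \<psi>" using z by (auto simp: alternation_def)
      have "z = x" by (rule F.head_inj[OF f(1) m(1)]) (use z(2) m(5) v in auto)
      then show False using f(2) second_edge[OF m(2)] by simp
    qed
    have "flip z = y'" by (rule S.tail_inj[OF f m(4)]) (use z(2) m(7) v in auto)
    then show ?thesis by (metis flip_sel(4))
  qed
  moreover have "y \<in> alternation" "flip y' \<in> alternation"
    using m(3,4,8,9) by (simp_all add: alternation_def)
  ultimately show ?thesis using split[OF m(1-7)] by blast
qed

lemma finite_alternation: "finite alternation"
proof -
  have "alternation \<subseteq> F.D \<union> flip ` S.D"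
    by (auto simp: alternation_def image_iff) (metis flip_sel(4))
  then show ?thesis using F.finite_D S.finite_D by (meson finite_UnI finite_imageI finite_subset)
qed

lemma alternation_linkage: "linkage alternation {s1, r2} {r1, s2}"
proof (rule linkageI[where W = inner])
  show "head x \<in> inner \<union> {r1, s2}" if "x \<in> alternation" for x
    using that first_head[of x] second_tail[of "flip x"] by (auto simp: alternation_def)
  show "tail x \<in> inner \<union> {s1, r2}" if "x \<in> alternation" for x
    using that first_tail[of x] second_head[of "flip x"] by (auto simp: alternation_def)
  show "\<exists>!x. x \<in> alternation \<and> head x = v" if "v \<in> inner" for v
    using that
  proof (cases rule: alternation_cases)
    case (merge x x' y)
    then show ?thesis by (intro ex1I[of _ x]) blast+
  next
    case (split x y y')
    show ?thesis
    proof (intro ex1I[of _ "flip y'"] conjI)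
      show "head (flip y') = v" using split(7) by simp
    qed (use split(9,10) in blast)+
  qed
  show "\<exists>!x. x \<in> alternation \<and> tail x = v" if "v \<in> inner" for v
    using that
  proof (cases rule: alternation_cases)
    case (merge x x' y)
    show ?thesis
    proof (intro ex1I[of _ "flip x'"] conjI)
      show "tail (flip x') = v" using merge(6) by simp
    qed (use merge(9,11) in blast)+
  next
    case (split x y y')
    then show ?thesis by (intro ex1I[of _ y]) blast+
  qed
qed (use terminals_distinct finite_alternation in auto)

sublocale A: linkage alternation "{s1, r2}" "{r1, s2}" by (rule alternation_linkage)

text \<open>
  On every cycle of alternating steps the private \<open>\<phi>\<close>-edges are exchanged for the private
  \<open>\<psi>\<close>-edges, which resume their own direction.
\<close>
definition rerouted :: "('v, 'e) step set" where
  "rerouted = (F.D - A.residue) \<union> {x \<in> S.D. flip x \<in> A.residue}"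

lemma residue_alternation: "z \<in> A.residue \<Longrightarrow> z \<in> alternation"
  by (simp add: A.residue_def)

lemma residue_interior:
  assumes z: "z \<in> A.residue" shows "tail z \<in> inner" "head z \<in> inner"
proof -
  note a = residue_alternation[OF z]
  have "tail z \<in> verts G" "head z \<in> verts G"
    using a F.step_edge(5,6)[of z] S.step_edge(5,6)[of "flip z"] by (auto simp: alternation_def)
  then show "tail z \<in> inner" "head z \<in> inner"
    using A.residue_tail[OF z] A.tail_notin[OF a] A.residue_head[OF z] A.head_notin[OF a] by auto
qed

lemma shared_not_residue:
  assumes "x \<in> F.D" "x \<in> S.D" shows "x \<notin> A.residue"
  using residue_alternation[of x] first_edge[OF assms(1)]
    second_edge[OF assms(2)] by (auto simp: alternation_def)

text \<open>
  Where the families merge, a cycle contains both private edges or neither, so exactly one of them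
  enters the vertex in the rerouted set; the outgoing shared edge stays. The case of a split is
  dual.
\<close>
lemma rerouted_linkage: "linkage rerouted {s1} {r1}"
proof (rule linkageI[where W = inner])
  show "finite rerouted" using F.finite_D S.finite_D by (simp add: rerouted_def)
  show "head x \<in> inner \<union> {r1}" if "x \<in> rerouted" for x
    using that first_head[of x] residue_interior[of "flip x"] by (auto simp: rerouted_def)
  show "tail x \<in> inner \<union> {s1}" if "x \<in> rerouted" for x
    using that first_tail[of x] residue_interior[of "flip x"] by (auto simp: rerouted_def)
  fix v assume v: "v \<in> inner"
  then have v': "v \<notin> {s1}" "v \<notin> {r1}" "v \<notin> {s2}" "v \<notin> {r2}" by auto
  have "(\<exists>!x. x \<in> rerouted \<and> head x = v) \<and> (\<exists>!x. x \<in> rerouted \<and> tail x = v)"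
    using v
  proof (cases rule: alternation_cases)
    case m: (merge x x' y)
    have both: "x \<in> A.residue \<longleftrightarrow> flip x' \<in> A.residue"
    proof
      assume "x \<in> A.residue"
      from A.residue_succ[OF this] show "flip x' \<in> A.residue"
        using m residue_alternation by metis
    next
      assume "flip x' \<in> A.residue"
      from A.residue_pred[OF this] show "x \<in> A.residue"
        using m residue_alternation by (metis flip_sel(1))
    qed
    have inF: "z = x" if "z \<in> F.D" "head z = v" for z
      by (rule F.head_inj[OF that(1) m(1)]) (use that(2) m(5-7) v' in auto)
    have inS: "z = x'" if "z \<in> S.D" "head z = v" for z
      by (rule S.head_inj[OF that(1) m(2)]) (use that(2) m(5-7) v' in auto)
    have outF: "z = y" if "z \<in> F.D" "tail z = v" for z
      by (rule F.tail_inj[OF that(1) m(3)]) (use that(2) m(5-7) v' in auto)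
    have outS: "z = y" if "z \<in> S.D" "tail z = v" for z
      by (rule S.tail_inj[OF that(1) m(4)]) (use that(2) m(5-7) v' in auto)
    have "\<exists>!z. z \<in> rerouted \<and> head z = v"
    proof (cases "x \<in> A.residue")
      case True
      then have "x' \<in> rerouted" using both m(2) by (simp add: rerouted_def)
      moreover have "z = x'" if "z \<in> rerouted" "head z = v" for z
        using that inF inS True unfolding rerouted_def by blast
      ultimately show ?thesis using m(6) by blast
    next
      case False
      then have "x \<in> rerouted" using m(1) by (simp add: rerouted_def)
      moreover have "z = x" if "z \<in> rerouted" "head z = v" for z
        using that inF inS both False unfolding rerouted_def by blast
      ultimately show ?thesis using m(5) by blast
    qed
    moreover have "y \<in> rerouted" using m(3) shared_not_residue[OF m(3,4)] by (simp add: rerouted_def)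
    then have "\<exists>!z. z \<in> rerouted \<and> tail z = v"
      using m(7) outF outS unfolding rerouted_def by blast
    ultimately show ?thesis ..
  next
    case m: (split x y y')
    have both: "y \<in> A.residue \<longleftrightarrow> flip y' \<in> A.residue"
    proof
      assume "y \<in> A.residue"
      from A.residue_pred[OF this] show "flip y' \<in> A.residue"
        using m residue_alternation by metis
    next
      assume "flip y' \<in> A.residue"
      from A.residue_succ[OF this] show "y \<in> A.residue"
        using m residue_alternation by (metis flip_sel(2))
    qed
    have inF: "z = x" if "z \<in> F.D" "head z = v" for z
      by (rule F.head_inj[OF that(1) m(1)]) (use that(2) m(5-7) v' in auto)
    have inS: "z = x" if "z \<in> S.D" "head z = v" for z
      by (rule S.head_inj[OF that(1) m(2)]) (use that(2) m(5-7) v' in auto)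
    have outF: "z = y" if "z \<in> F.D" "tail z = v" for z
      by (rule F.tail_inj[OF that(1) m(3)]) (use that(2) m(5-7) v' in auto)
    have outS: "z = y'" if "z \<in> S.D" "tail z = v" for z
      by (rule S.tail_inj[OF that(1) m(4)]) (use that(2) m(5-7) v' in auto)
    have "\<exists>!z. z \<in> rerouted \<and> tail z = v"
    proof (cases "y \<in> A.residue")
      case True
      then have "y' \<in> rerouted" using both m(4) by (simp add: rerouted_def)
      moreover have "z = y'" if "z \<in> rerouted" "tail z = v" for z
        using that outF outS True unfolding rerouted_def by blast
      ultimately show ?thesis using m(7) by blast
    next
      case False
      then have "y \<in> rerouted" using m(3) by (simp add: rerouted_def)
      moreover have "z = y" if "z \<in> rerouted" "tail z = v" for z
        using that outF outS both False unfolding rerouted_def by blast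
      ultimately show ?thesis using m(6) by blast
    qed
    moreover have "x \<in> rerouted" using m(1) shared_not_residue[OF m(1,2)] by (simp add: rerouted_def)
    then have "\<exists>!z. z \<in> rerouted \<and> head z = v"
      using m(5) inF inS unfolding rerouted_def by blast
    ultimately show ?thesis by blast
  qed
  then show "\<exists>!x. x \<in> rerouted \<and> head x = v" "\<exists>!x. x \<in> rerouted \<and> tail x = v" by auto
qed (use terminals_distinct in auto)

text \<open>
  Consecutive alternating steps come from different families, so a cycle cannot consist of
  \<open>\<psi>\<close>-edges alone.
\<close>
lemma residue_meets_first:
  assumes z: "z \<in> A.residue" shows "\<exists>y \<in> A.residue. y \<in> F.D"
  using residue_interior(2)[OF z]
proof (cases rule: alternation_cases)
  case (merge x x' y)
  then have "z = x" using residue_alternation[OF z] by blast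
  then show ?thesis using z merge(1) by blast
next
  case (split x y y')
  obtain w where "w \<in> A.residue" "tail w = head z" using A.residue_succ[OF z] by blast
  then show ?thesis using split(3,11) residue_alternation by metis
qed

text \<open>
  A cycle would contain a private \<open>\<phi>\<close>-edge, and the paths found in the rerouted set, together with
  \<open>\<psi>\<close>, would avoid this edge.
\<close>
lemma residue_empty: "A.residue = {}"
proof (rule ccontr)
  assume "A.residue \<noteq> {}"
  then obtain z where z: "z \<in> A.residue" "z \<in> F.D" using residue_meets_first by blast
  have sub: "rerouted \<subseteq> directed_steps G"
    unfolding rerouted_def using F.step_directed S.step_directed by blast
  obtain \<phi>' where \<phi>': "disjoint_paths G s1 r1 \<phi>'"
    "card \<phi>' = card {x \<in> rerouted. tail x = s1}" "family_steps \<phi>' \<subseteq> rerouted"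
    by (rule linkage_disjoint_paths[OF rerouted_linkage sub])
  have "{x \<in> rerouted. tail x = s1} = {x \<in> F.D. tail x = s1}"
  proof (intro equalityI subsetI)
    fix x assume "x \<in> {x \<in> rerouted. tail x = s1}"
    then show "x \<in> {x \<in> F.D. tail x = s1}"
      using residue_interior(2)[of "flip x"] by (auto simp: rerouted_def)
  next
    fix x assume "x \<in> {x \<in> F.D. tail x = s1}"
    then show "x \<in> {x \<in> rerouted. tail x = s1}"
      using residue_interior(1)[of x] by (auto simp: rerouted_def)
  qed
  then have "card \<phi>' = card \<phi>" using \<phi>'(2) F.card_out_source by simp
  then have "edges G = family_edges \<phi>' \<union> family_edges \<psi>" using irredundant \<phi>'(1) by blast
  then have "edge z \<in> family_edges \<phi>' \<union> family_edges \<psi>" using F.step_edge(1)[OF z(2)] by simp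
  moreover have "edge z \<notin> family_edges \<psi>"
    using residue_alternation[OF z(1)] first_edge[OF z(2)] by (auto simp: alternation_def)
  moreover have "edge z \<notin> family_edges \<phi>'"
  proof
    assume "edge z \<in> family_edges \<phi>'"
    then obtain w where w: "w \<in> rerouted" "edge w = edge z"
      using \<phi>'(3) by (auto simp: family_edges_eq_image)
    then show False
      using F.edge_inj[of w z] z second_edge[of w] \<open>edge z \<notin> family_edges \<psi>\<close>
      by (auto simp: rerouted_def)
  qed
  ultimately show False by blast
qed

lemma alternation_edge_inj:
  assumes "x \<in> alternation" "y \<in> alternation" "edge x = edge y" shows "x = y"
  using assms F.edge_inj[of x y] S.edge_inj[of "flip x" "flip y"] first_edge[of x] first_edge[of y]
  by (auto simp: alternation_def)

lemma alternation_edges: "edge ` alternation = edges G - family_edges \<phi> \<inter> family_edges \<psi>"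
proof
  show "edge ` alternation \<subseteq> edges G - family_edges \<phi> \<inter> family_edges \<psi>"
    using F.step_edge(1) S.step_edge(1)[of "flip x" for x] by (fastforce simp: alternation_def)
  show "edges G - family_edges \<phi> \<inter> family_edges \<psi> \<subseteq> edge ` alternation"
  proof
    fix e assume e: "e \<in> edges G - family_edges \<phi> \<inter> family_edges \<psi>"
    then consider "e \<in> family_edges \<phi>" "e \<notin> family_edges \<psi>" | "e \<in> family_edges \<psi>" "e \<notin> family_edges \<phi>"
      using cover by blast
    then show "e \<in> edge ` alternation"
    proof cases
      case 1
      then show ?thesis by (auto simp: alternation_def family_edges_eq_image)
    next
      case 2
      then obtain x where "x \<in> S.D" "edge x = e" by (auto simp: family_edges_eq_image)
      then have "flip x \<in> alternation" "edge (flip x) = e" using 2 by (auto simp: alternation_def)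
      then show ?thesis by blast
    qed
  qed
qed

text \<open>
  All edges at terminals are private, so each path of \<open>\<phi>\<close> contributes its first edge and each path of
  \<open>\<psi>\<close> its last one.
\<close>
lemma card_starts: "card A.starts = card \<phi> + card \<psi>"
proof -
  have "{x \<in> alternation. tail x = s1} = {x \<in> F.D. tail x = s1}"
  proof (intro equalityI subsetI)
    fix x assume "x \<in> {x \<in> F.D. tail x = s1}"
    then have x: "x \<in> F.D" "tail x = s1" by auto
    have "edge x \<notin> family_edges \<psi>"
      using oriented[OF x(1)] second_tail[of x] x terminals_distinct by auto
    then show "x \<in> {x \<in> alternation. tail x = s1}" using x by (simp add: alternation_def)
  next
    fix x assume "x \<in> {x \<in> alternation. tail x = s1}"
    then show "x \<in> {x \<in> F.D. tail x = s1}"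
      using second_head[of "flip x"] terminals_distinct by (auto simp: alternation_def)
  qed
  moreover have "{x \<in> alternation. tail x = r2} = flip ` {x \<in> S.D. head x = r2}"
  proof (intro equalityI subsetI)
    fix x assume "x \<in> flip ` {x \<in> S.D. head x = r2}"
    then obtain y where y: "x = flip y" "y \<in> S.D" "head y = r2" by auto
    have "edge y \<notin> family_edges \<phi>"
    proof
      assume "edge y \<in> family_edges \<phi>"
      then obtain z where z: "z \<in> F.D" "edge z = edge y" by (auto simp: family_edges_eq_image)
      then have "z \<in> S.D" using oriented second_edge[OF y(2)] by simp
      then have "z = y" using S.edge_inj z y by blast
      then show False using first_head[OF z(1)] y terminals_distinct by auto
    qed
    then show "x \<in> {x \<in> alternation. tail x = r2}" using y by (simp add: alternation_def)
  next
    fix x assume "x \<in> {x \<in> alternation. tail x = r2}"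
    then have x: "flip x \<in> S.D" "head (flip x) = r2"
      using first_tail[of x] terminals_distinct by (auto simp: alternation_def)
    then show "x \<in> flip ` {x \<in> S.D. head x = r2}" by (intro image_eqI[of _ _ "flip x"]) simp_all
  qed
  moreover have "card (flip ` {x \<in> S.D. head x = r2}) = card {x \<in> S.D. head x = r2}"
    by (intro card_image inj_onI) simp
  moreover have "A.starts = {x \<in> alternation. tail x = s1} \<union> {x \<in> alternation. tail x = r2}"
    by (auto simp: A.starts_def)
  moreover have "card ({x \<in> alternation. tail x = s1} \<union> {x \<in> alternation. tail x = r2}) =
     card {x \<in> alternation. tail x = s1} + card {x \<in> alternation. tail x = r2}"
    using terminals_distinct finite_alternation by (intro card_Un_disjoint) auto
  ultimately show ?thesis using F.card_out_source S.card_into_sink by simp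
qed

lemma alternation_undirected: "alternation \<subseteq> undirected_steps G"
proof
  fix x assume "x \<in> alternation"
  then have "x \<in> directed_steps G \<or> flip x \<in> directed_steps G"
    unfolding alternation_def using F.step_directed S.step_directed by blast
  then show "x \<in> undirected_steps G"
    by (cases x) (auto simp: undirected_steps_def directed_steps_def flip_def)
qed

lemma walk_edges_chosen_threads: "(\<Union>p \<in> A.chosen_thread ` A.starts. walk_edges p) =
   edges G - family_edges \<phi> \<inter> family_edges \<psi>"
proof -
  have all: "(\<Union>x \<in> A.starts. set (A.chosen_thread x)) = alternation"
    using residue_empty A.chosen_thread_subset unfolding A.residue_def by blast
  have "(\<Union>p \<in> A.chosen_thread ` A.starts. walk_edges p) =
      edge ` (\<Union>x \<in> A.starts. set (A.chosen_thread x))"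
    by (simp add: walk_edges_def split_def image_UN)
  then show ?thesis unfolding all alternation_edges .
qed

lemma walk_edges_disjoint: "disjoint_family_on walk_edges (A.chosen_thread ` A.starts)"
proof (unfold disjoint_family_on_def, intro ballI impI)
  fix p q assume "p \<in> A.chosen_thread ` A.starts" "q \<in> A.chosen_thread ` A.starts" "p \<noteq> q"
  then obtain x y where xy: "x \<in> A.starts" "y \<in> A.starts" "x \<noteq> y"
    "p = A.chosen_thread x" "q = A.chosen_thread y" by blast
  show "walk_edges p \<inter> walk_edges q = {}"
  proof (rule ccontr)
    assume "walk_edges p \<inter> walk_edges q \<noteq> {}"
    then obtain a b where ab: "a \<in> set p" "b \<in> set q" "edge a = edge b"
      unfolding walk_edges_def split_def by blast
    then have "a = b"
      using alternation_edge_inj A.chosen_thread_subset[OF xy(1)] A.chosen_thread_subset[OF xy(2)] xy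
      by blast
    then show False using A.chosen_threads_disjoint[OF xy(1,2)] ab xy by blast
  qed
qed

lemma chosen_thread_alternating:
  assumes x: "x \<in> A.starts"
  shows "\<exists>a \<in> {s1, r2}. \<exists>b \<in> {r1, s2}. path (undirected_steps G) a (A.chosen_thread x) b \<and>
     (set (walk_verts a (A.chosen_thread x)) - {a, b}) \<inter> {s1, s2, r1, r2} = {}"
proof -
  note t = A.chosen_thread[OF x]
  have tx: "tail x \<in> {s1, r2}" using x by (simp add: A.starts_def)
  obtain b where b: "b \<in> {r1, s2}" "path alternation (tail x) (A.chosen_thread x) b"
    using t unfolding A.thread_def by blast
  then have w: "walk alternation (tail x) (A.chosen_thread x) b" by (simp add: path_def)
  have "path (undirected_steps G) (tail x) (A.chosen_thread x) b"
    using b walk_mono[OF w] walk_subset[OF w] alternation_undirected unfolding path_def by blast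
  moreover have "(set (walk_verts (tail x) (A.chosen_thread x)) - {tail x, b}) \<inter> {s1, s2, r1, r2} = {}"
    using A.thread_interior[OF t tx w] by blast
  ultimately show ?thesis using tx b by blast
qed

end

section \<open>Minimal networks\<close>

lemma disjoint_paths_delete_edge:
  assumes "disjoint_paths G s r \<phi>" "e \<notin> family_edges \<phi>"
  shows "disjoint_paths (delete_edge G e) s r \<phi>"
proof -
  have "path (directed_steps (delete_edge G e)) s p r" if p: "p \<in> \<phi>" for p
  proof -
    have w: "path (directed_steps G) s p r" using assms p by (simp add: disjoint_paths_def)
    then have "set p \<subseteq> directed_steps G" using walk_subset by (metis path_def)
    moreover have "\<forall>x \<in> set p. edge x \<noteq> e"
      using assms(2) p unfolding family_edges_eq_image family_steps_def by blast
    ultimately have "set p \<subseteq> directed_steps (delete_edge G e)"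
      by (fastforce simp: directed_steps_def delete_edge_def)
    then show ?thesis using w walk_mono by (auto simp: path_def)
  qed
  then show ?thesis using assms by (simp add: disjoint_paths_def)
qed

lemma disjoint_paths_undelete:
  assumes "disjoint_paths (delete_edge G e) s r \<phi>"
  shows "disjoint_paths G s r \<phi>"
proof -
  have "directed_steps (delete_edge G e) \<subseteq> directed_steps G"
    by (auto simp: directed_steps_def delete_edge_def)
  then have "path (directed_steps G) s p r" if "path (directed_steps (delete_edge G e)) s p r" for p
    using that walk_mono walk_subset unfolding path_def by (metis subset_trans)
  then show ?thesis using assms by (simp add: disjoint_paths_def)
qed

lemma max_disjoint_paths_delete_edge:
  assumes "max_disjoint_paths G s r C" "disjoint_paths G s r \<phi>" "card \<phi> = C" "e \<notin> family_edges \<phi>"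
  shows "max_disjoint_paths (delete_edge G e) s r C"
  using assms disjoint_paths_delete_edge disjoint_paths_undelete unfolding max_disjoint_paths_def by metis

text \<open>
  An edge missed by both families could be deleted: they would survive, and deletion cannot increase the
  number of disjoint paths.
\<close>
lemma minimal_network_covered:
  assumes min: "minimal_network C1 C2 G"
    and \<phi>: "disjoint_paths G (src1 G) (snk1 G) \<phi>" "card \<phi> = C1"
    and \<psi>: "disjoint_paths G (src2 G) (snk2 G) \<psi>" "card \<psi> = C2"
  shows "edges G = family_edges \<phi> \<union> family_edges \<psi>"
proof
  have G: "G \<in> networks C1 C2" using min by (simp add: minimal_network_def)
  have sub: "family_edges \<phi> \<subseteq> edges G" if "disjoint_paths G s r \<phi>" for s r \<phi>
  proof -
    have "set p \<subseteq> directed_steps G" if "p \<in> \<phi>" for p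
      using that \<open>disjoint_paths G s r \<phi>\<close> walk_subset by (fastforce simp: disjoint_paths_def path_def)
    then show ?thesis by (fastforce simp: family_edges_eq_image family_steps_def directed_steps_def)
  qed
  show "family_edges \<phi> \<union> family_edges \<psi> \<subseteq> edges G" using sub \<phi> \<psi> by blast
  show "edges G \<subseteq> family_edges \<phi> \<union> family_edges \<psi>"
  proof
    fix e assume e: "e \<in> edges G"
    show "e \<in> family_edges \<phi> \<union> family_edges \<psi>"
    proof (rule ccontr)
      assume ne: "e \<notin> family_edges \<phi> \<union> family_edges \<psi>"
      have "max_disjoint_paths (delete_edge G e) (src1 G) (snk1 G) C1"
        "max_disjoint_paths (delete_edge G e) (src2 G) (snk2 G) C2"
        using G \<phi> \<psi> ne by (auto intro!: max_disjoint_paths_delete_edge simp: networks_def)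
      then have "delete_edge G e \<in> networks C1 C2"
        using G by (simp add: networks_def delete_edge_def finite_loopless_def is_source_def
            is_sink_def ends_def terminals_def directed_edge_def undirected_edge_def)
      then show False using min e by (simp add: minimal_network_def)
    qed
  qed
qed

lemma mem_natural_direction:
  "(tail x, head x) \<in> natural_direction \<phi> (edge x) \<longleftrightarrow> x \<in> family_steps \<phi>"
  by (cases x) (simp add: natural_direction_def family_steps_def)

lemma path_choice_cubic_pair:
  assumes G: "G \<in> oriented_networks C1 C2" and c: "path_choice C1 C2 G \<phi> \<psi>"
  shows "cubic_pair G (src1 G) (snk1 G) (src2 G) (snk2 G) \<phi> \<psi>"
proof -
  have min: "minimal_network C1 C2 G" and N: "G \<in> networks C1 C2"
    and deg: "\<forall>v \<in> verts G - terminals G. degree G v = 3"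
    using G by (auto simp: oriented_networks_def minimal_network_def)
  show ?thesis
  proof
    show "edges G = family_edges \<phi> \<union> family_edges \<psi>"
      using minimal_network_covered[OF min] c by (simp add: path_choice_def)
    show "degree G v = 3" if "v \<in> verts G - {src1 G, src2 G, snk1 G, snk2 G}" for v
      using deg that by (simp add: terminals_def)
  qed (use N c in \<open>auto simp: networks_def path_choice_def\<close>)
qed

theorem theorem3p4:
  fixes G :: "('v, 'e) network" and C1 C2 :: nat
    and \<phi> \<psi> :: "('v, 'e) step list set"
  assumes "C1 > 0" and "C2 > 0"
    and "G \<in> oriented_networks C1 C2"
    and "path_choice C1 C2 G \<phi> \<psi>"
  shows "\<exists>P. finite P \<and> card P = C1 + C2 \<and> (\<forall>p \<in> P. alternating_path G \<phi> \<psi> p) \<and>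
           disjoint_family_on walk_edges P \<and>
           edges (private_subgraph G \<phi> \<psi>) = (\<Union>p \<in> P. walk_edges p)"
proof -
  have min: "minimal_network C1 C2 G" using assms(3) by (simp add: oriented_networks_def)
  obtain \<alpha> \<beta> where \<alpha>\<beta>: "path_choice C1 C2 G \<alpha> \<beta>" and nat: "naturally_oriented \<alpha> \<beta>"
    using assms(3) by (auto simp: oriented_networks_def naturally_orientable_def)
  \<comment> \<open>The mixed choice shares one family with each of the other two, so the edge sets can be
    compared one family at a time.\<close>
  have "path_choice C1 C2 G \<phi> \<beta>" using \<alpha>\<beta> assms(4) by (simp add: path_choice_def)
  note pairs = path_choice_cubic_pair[OF assms(3) this] path_choice_cubic_pair[OF assms(3) \<alpha>\<beta>]
    path_choice_cubic_pair[OF assms(3,4)]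
  have "family_edges \<phi> = family_edges \<alpha>" by (rule family_edges_unique[OF pairs(1,2)])
  moreover have "family_edges \<psi> = family_edges \<beta>"
    by (rule family_edges_unique[OF cubic_pair.swap[OF pairs(3)] cubic_pair.swap[OF pairs(1)]])
  ultimately have priv: "private_edges G \<phi> \<psi> = edges G - family_edges \<alpha> \<inter> family_edges \<beta>"
    by (simp add: private_edges_def public_edges_def family_edges_def)
  interpret oriented_cubic_pair G "src1 G" "snk1 G" "src2 G" "snk2 G" \<alpha> \<beta>
  proof (rule oriented_cubic_pair.intro[OF pairs(2)], unfold_locales)
    fix x :: "('v, 'e) step"
    assume x: "x \<in> family_steps \<alpha>" "edge x \<in> family_edges \<beta>"
    have "edge x \<in> public_edges \<alpha> \<beta>"
      using x unfolding public_edges_def family_edges_def[symmetric] by (simp add: family_edges_eq_image)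
    then have "natural_direction \<alpha> (edge x) = natural_direction \<beta> (edge x)"
      using nat by (simp add: naturally_oriented_def)
    then show "x \<in> family_steps \<beta>" using x(1) by (simp flip: mem_natural_direction)
  next
    fix \<alpha>' assume "disjoint_paths G (src1 G) (snk1 G) \<alpha>'" "card \<alpha>' = card \<alpha>"
    then show "edges G = family_edges \<alpha>' \<union> family_edges \<beta>"
      using minimal_network_covered[OF min] \<alpha>\<beta> by (simp add: path_choice_def)
  qed
  let ?P = "A.chosen_thread ` A.starts"
  have "card ?P = C1 + C2"
    using card_image[OF A.chosen_thread_inj] card_starts \<alpha>\<beta> by (simp add: path_choice_def)
  moreover have "alternating_path G \<phi> \<psi> p" if p: "p \<in> ?P" for p
  proof -
    have "walk_edges p \<subseteq> private_edges G \<phi> \<psi>" using p walk_edges_chosen_threads priv by blast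
    moreover obtain a b where "a \<in> {src1 G, snk2 G}" "b \<in> {snk1 G, src2 G}"
      "path (undirected_steps G) a p b"
      "(set (walk_verts a p) - {a, b}) \<inter> {src1 G, src2 G, snk1 G, snk2 G} = {}"
      using p chosen_thread_alternating by blast
    ultimately show ?thesis unfolding alternating_path_def terminals_def by blast
  qed
  moreover have "edges (private_subgraph G \<phi> \<psi>) = (\<Union>p \<in> ?P. walk_edges p)"
    by (simp only: walk_edges_chosen_threads private_subgraph_def priv) simp
  ultimately show ?thesis using A.finite_starts walk_edges_disjoint by blast
qed

end
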